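(* Let $n\ge2$, $m=n-1$. Let $\lambda\in\mathbb R$, let $(k,\alpha,\beta)\in\mathbb N^3$ be such that $\alpha+\beta=k$, and set $\delta=\beta-\alpha$. Consider the function $G_{\alpha,\beta}$ on $\mathbb C\times\mathbb C^m\times\mathbb C^m$ given by $$G_{\alpha,\beta}(s,u,v)=\frac{(2s)^\alpha}{\left(1+4|s|^2+\|u\|^2+\|v\|^2\right)^{\frac{i\lambda+k}{2}+n}},$$ which is the non-compact form of the highest weight vector $P_0^{\alpha,\beta}$. Then for all $(s,u,v)\in\mathbb C\times\mathbb C^m\times\mathbb C^m$ such that $s\ne0$ and $v\neq0$: $$\mathcal F(G_{\alpha,\beta})(s,u,v)=\int_{\mathbb C\times\mathbb C^m}\frac{(2\tau)^\alpha}{\left(1+4|\tau|^2+\|u\|^2+\|\xi\|^2\right)^{\frac{i\lambda+k}{2}+n}}\,e^{-2i\pi\mathrm{Re}(s\tau+\langle v,\xi\rangle)}\,d\tau\,d\xi = R(s,u,v)\,K_{\frac{i\lambda+\delta}{2}}\Big(\pi\sqrt{1+\|u\|^2}\sqrt{|s|^2+4\|v\|^2}\Big),$$ where $$R(s,u,v)=\frac{(-i\,\overline s)^{\alpha}\,\pi^{i\lambda+\beta+n}}{2^{\frac{i\lambda+k}{2}+1}\,\Gamma\big(\frac{i\lambda+k}{2}+n\big)}\left(\frac{\sqrt{|s|^2+4\|v\|^2}}{\pi\sqrt{1+\|u\|^2}}\right)^{\frac{i\lambda+\delta}{2}} .$$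
   Context: $\mathbb N$ contains $0$. $\langle x,y\rangle=\sum_{i=1}^m x_iy_i$ for $x,y\in\mathbb C^m$ (bilinear), $\|\cdot\|$ is the standard Hermitian norm on $\mathbb C^m$, and $d\tau$, $d\xi$ are Lebesgue measures on $\mathbb C\simeq\mathbb R^2$ and $\mathbb C^m\simeq\mathbb R^{2m}$. $\mathcal F=\mathcal F_\tau\circ\mathcal F_\xi$ is the partial Fourier transform with $\mathcal F_\xi(g)(s,u,v)=\int_{\mathbb C^m}g(s,u,\xi)e^{-2i\pi\mathrm{Re}\langle v,\xi\rangle}d\xi$ and $\mathcal F_\tau(g)(s,u,v)=\int_{\mathbb C}g(\tau,u,v)e^{-2i\pi\mathrm{Re}(s\tau)}d\tau$. The integral over $\mathbb C\times\mathbb C^m$ in the claim is to be understood as the corresponding iterated integral, first over $\xi$ and then over $\tau$. $P_0^{\alpha,\beta}(z,w,\bar z,\bar w)=w_1^\alpha\bar z_1^{\,\beta}$ on $\mathbb C^{2n}$ (coordinates $(z,w)\in\mathbb C^n\times\mathbb C^n$). Its non-compact form is obtained by extending $P_0^{\alpha,\beta}|_{S^{4n-1}}$ to the function $g$ on $\mathbb C^{2n}\setminus\{0\}$ satisfying $g(c\,\cdot)=(c/|c|)^{-\delta}|c|^{-i\lambda-2n}g(\cdot)$ for all $c\in\mathbb C\setminus\{0\}$ and setting $G_{\alpha,\beta}(s,u,v)=g(1,u,2s,v)$, with $z=(1,u)$, $w=(2s,v)$. $K_\nu$ is the modified Bessel function of the third kind: $K_\nu(z)=\frac\pi2\frac{I_{-\nu}(z)-I_\nu(z)}{\sin(\nu\pi)}$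 for $\nu\notin\mathbb Z$ (limit in $\nu$ for $\nu\in\mathbb Z$), where $I_\nu(z)=\sum_{k\ge0}\frac{1}{\Gamma(k+1)\Gamma(k+\nu+1)}\left(\frac z2\right)^{\nu+2k}$. Complex powers of positive reals are $x^c=e^{c\ln x}$. *)

theory Defs
  imports "HOL-Analysis.Analysis"
begin

text \<open>
  Throughout, \<open>'m\<close> indexes the coordinates of \<open>\<complex>\<^sup>m\<close>, and \<open>\<complex>\<^sup>n\<close> with \<open>n = m + 1\<close> is indexed by
  \<open>'m option\<close>: the coordinate \<open>None\<close> is the first one, and \<open>Some j\<close> are the remaining \<open>m\<close>.
\<close>

definition bilin :: "complex ^ 'm::finite \<Rightarrow> complex ^ 'm \<Rightarrow> complex" where
  "bilin x y = (\<Sum>i\<in>UNIV. x $ i * y $ i)"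

definition vcons :: "complex \<Rightarrow> complex ^ 'm::finite \<Rightarrow> complex ^ 'm option" where
  "vcons a u = (\<chi> i. case i of None \<Rightarrow> a | Some j \<Rightarrow> u $ j)"


definition F_xi ::
  "(complex \<Rightarrow> complex ^ 'm::finite \<Rightarrow> complex ^ 'm \<Rightarrow> complex)
    \<Rightarrow> complex \<Rightarrow> complex ^ 'm \<Rightarrow> complex ^ 'm \<Rightarrow> complex" where
  "F_xi g = (\<lambda>s u v. LINT \<xi>|lborel.
      g s u \<xi> * exp (- 2 * \<i> * complex_of_real pi * complex_of_real (Re (bilin v \<xi>))))"

definition F_tau ::
  "(complex \<Rightarrow> complex ^ 'm::finite \<Rightarrow> complex ^ 'm \<Rightarrow> complex)
    \<Rightarrow> complex \<Rightarrow> complex ^ 'm \<Rightarrow> complex ^ 'm \<Rightarrow> complex" where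
  "F_tau g = (\<lambda>s u v. LINT \<tau>|lborel.
      g \<tau> u v * exp (- 2 * \<i> * complex_of_real pi * complex_of_real (Re (s * \<tau>))))"

definition partial_fourier ::
  "(complex \<Rightarrow> complex ^ 'm::finite \<Rightarrow> complex ^ 'm \<Rightarrow> complex)
    \<Rightarrow> complex \<Rightarrow> complex ^ 'm \<Rightarrow> complex ^ 'm \<Rightarrow> complex" where
  "partial_fourier = F_tau \<circ> F_xi"


text \<open>
  The coefficients use the entire function \<open>rGamma = 1 / Gamma\<close>, which vanishes at the poles of
  \<open>Gamma\<close>; \<open>powr\<close> is the principal branch, so on positive reals \<open>x powr c = exp (c * ln x)\<close>.
\<close>

definition bessel_I :: "complex \<Rightarrow> complex \<Rightarrow> complex" where
  "bessel_I \<nu> z =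
    (\<Sum>k. rGamma (of_nat k + 1) * rGamma (of_nat k + \<nu> + 1) * (z / 2) powr (\<nu> + 2 * of_nat k))"

definition bessel_K_quotient :: "complex \<Rightarrow> complex \<Rightarrow> complex" where
  "bessel_K_quotient \<nu> z =
    complex_of_real pi / 2 * ((bessel_I (- \<nu>) z - bessel_I \<nu> z) / sin (\<nu> * complex_of_real pi))"

definition bessel_K :: "complex \<Rightarrow> complex \<Rightarrow> complex" where
  "bessel_K \<nu> z =
    (if \<nu> \<notin> \<int> then bessel_K_quotient \<nu> z else Lim (at \<nu>) (\<lambda>\<mu>. bessel_K_quotient \<mu> z))"


text \<open>The polynomial \<open>w\<^sub>1\<^sup>\<alpha> z\<^sub>1\<^sup>\<beta>\<close>, with \<open>z\<^sub>1\<close> conjugated, as a function of \<open>z, w\<close>.\<close>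

definition P0 :: "nat \<Rightarrow> nat \<Rightarrow> complex ^ 'm::finite option \<Rightarrow> complex ^ 'm option \<Rightarrow> complex" where
  "P0 \<alpha> \<beta> z w = (w $ None) ^ \<alpha> * cnj (z $ None) ^ \<beta>"

text \<open>
  \<open>g\<close> extends the restriction of \<open>P\<close> to the unit sphere to a homogeneous function away from the
  origin. The two conditions determine \<open>g\<close> on nonzero arguments; \<open>g 0 0\<close> is irrelevant.
\<close>

definition homogeneous_extension ::
  "nat \<Rightarrow> real \<Rightarrow> int \<Rightarrow> (complex ^ 'a::finite \<Rightarrow> complex ^ 'a \<Rightarrow> complex)
    \<Rightarrow> (complex ^ 'a \<Rightarrow> complex ^ 'a \<Rightarrow> complex) \<Rightarrow> bool" where
  "homogeneous_extension n lam \<delta> P g \<longleftrightarrow>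
    (\<forall>z w. norm (z, w) = 1 \<longrightarrow> g z w = P z w) \<and>
    (\<forall>c z w. c \<noteq> 0 \<longrightarrow> (z, w) \<noteq> (0, 0) \<longrightarrow>
      g (c *s z) (c *s w) =
        (c / complex_of_real (cmod c)) powi (- \<delta>) *
        complex_of_real (cmod c) powr (- \<i> * complex_of_real lam - 2 * of_nat n) * g z w)"

definition is_noncompact_form ::
  "nat \<Rightarrow> real \<Rightarrow> int \<Rightarrow> (complex ^ 'm::finite option \<Rightarrow> complex ^ 'm option \<Rightarrow> complex)
    \<Rightarrow> (complex \<Rightarrow> complex ^ 'm \<Rightarrow> complex ^ 'm \<Rightarrow> complex) \<Rightarrow> bool" where
  "is_noncompact_form n lam \<delta> P G \<longleftrightarrow>
    (\<exists>g. homogeneous_extension n lam \<delta> P g \<and>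
      (\<forall>s u v. G s u v = g (vcons 1 u) (vcons (2 * s) v)))"


definition G_fun ::
  "nat \<Rightarrow> real \<Rightarrow> nat \<Rightarrow> nat \<Rightarrow> complex \<Rightarrow> complex ^ 'm::finite \<Rightarrow> complex ^ 'm \<Rightarrow> complex" where
  "G_fun n lam k \<alpha> s u v =
    (2 * s) ^ \<alpha> /
    complex_of_real (1 + 4 * (cmod s)\<^sup>2 + (norm u)\<^sup>2 + (norm v)\<^sup>2)
      powr ((\<i> * complex_of_real lam + of_nat k) / 2 + of_nat n)"

definition R_fun ::
  "nat \<Rightarrow> real \<Rightarrow> nat \<Rightarrow> nat \<Rightarrow> nat \<Rightarrow> int
    \<Rightarrow> complex \<Rightarrow> complex ^ 'm::finite \<Rightarrow> complex ^ 'm \<Rightarrow> complex" where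
  "R_fun n lam k \<alpha> \<beta> \<delta> s u v =
    (- \<i> * cnj s) ^ \<alpha> *
    complex_of_real pi powr (\<i> * complex_of_real lam + of_nat \<beta> + of_nat n) /
    (2 powr ((\<i> * complex_of_real lam + of_nat k) / 2 + 1) *
     Gamma ((\<i> * complex_of_real lam + of_nat k) / 2 + of_nat n)) *
    complex_of_real (sqrt ((cmod s)\<^sup>2 + 4 * (norm v)\<^sup>2) / (pi * sqrt (1 + (norm u)\<^sup>2)))
      powr ((\<i> * complex_of_real lam + of_int \<delta>) / 2)"

end

theory Submission
  imports Defs "HOL-Probability.Characteristic_Functions"
begin

text \<open>
  Write \<open>X powr (- a)\<close> as \<open>1 / Gamma a\<close> times the integral of \<open>t powr (a - 1) * exp (- t X)\<close> over
  \<open>t > 0\<close>. For fixed \<open>t\<close> the transforms in \<open>\<xi>\<close> and \<open>\<tau>\<close> are Gaussian, the factor \<open>(2 \<tau>) ^ \<alpha>\<close>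
  contributing \<open>(- \<i> pi cnj s / (2 t)) ^ \<alpha>\<close>, and what remains is Schlaefli's integral of
  \<open>t powr (\<nu> - 1) * exp (- A t - C / t)\<close>. That integral is identified with the Bessel function
  through two Wronskian identities. When \<open>\<beta> = 0\<close> the integrand in \<open>\<tau>\<close> is only integrable because of
  the factor \<open>exp (- pi\<^sup>2 * (norm v)\<^sup>2 / t)\<close> produced by the \<open>\<xi>\<close>-transform; this is where \<open>v \<noteq> 0\<close> enters.
\<close>

subsection \<open>Gaussian integrals\<close>

text \<open>For \<beta> = 0 the modulus of the integrand is not integrable over \<tau> and \<xi>
  jointly: it decays with exponent \<beta> + 2 n in 2 n real dimensions. So there is no single
  interchange over all variables but two: t against \<xi> at fixed \<tau>, then t against \<tau> in
  the Schlaefli integral already obtained. Each real direction of \<xi> lowers the order by 1/2, the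
  \<tau>-Gaussian by 1 and the power of \<tau> by \<alpha>; as n = m + 1, the order (\<i> lam + k) /
  2 + n ends as (\<i> lam + \<delta>) / 2.

  K is defined by a quotient of series, so a differential equation for Schlaefli's integral would
  still leave two constants to find. Instead, a bilinear identity between integral and series, taken
  at \<nu> and at 1 - \<nu>, gives two linear equations for the integrals of these orders. Their
  determinant is the Wronskian of the series, sin (pi \<nu>) / pi, and elimination yields the
  quotient. The only limit taken is at argument 0, in a half plane of orders where Gamma integrals
  converge; recurrences reach the other orders.\<close>

lemma gaussian_fourier_real:
  fixes p \<omega> :: real
  assumes "p > 0"
  shows "integrable lborel (\<lambda>x. exp (- of_real (p * x\<^sup>2) - \<i> * of_real (\<omega> * x)) :: complex)"
    and "(LINT x|lborel. exp (- of_real (p * x\<^sup>2) - \<i> * of_real (\<omega> * x)) :: complex)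
           = of_real (sqrt (pi / p) * exp (- (\<omega>\<^sup>2 / (4 * p))))"
proof -
  \<comment> \<open>With this scale \<open>p * x\<^sup>2\<close> is half the square of
    \<open>c * x\<close>, so the integrand is a multiple of the standard normal density times a
    character, and the known characteristic function gives the value.\<close>
  define c where "c = sqrt (2 * p)"
  have c: "c > 0" "c\<^sup>2 = 2 * p" using assms by (auto simp: c_def)
  define t where "t = - \<omega> / c"
  let ?g = "\<lambda>x. std_normal_density x *\<^sub>R iexp (t * x)"
  have int: "integrable lborel ?g"
  proof (rule Bochner_Integration.integrable_bound[OF integrable_normal_density[of 1 0]])
    show "AE x in lborel. norm (?g x) \<le> norm (std_normal_density x)"
      by (auto simp: normal_density_nonneg)
  qed auto
  have val: "integral\<^sup>L lborel ?g = of_real (exp (- (t\<^sup>2) / 2))"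
    using fun_cong[OF char_std_normal_distribution, of t]
    unfolding char_def by (subst (asm) integral_density) (auto simp: normal_density_nonneg)
  have eq: "exp (- of_real (p * x\<^sup>2) - \<i> * of_real (\<omega> * x)) = sqrt (2 * pi) *\<^sub>R ?g (0 + c * x)" for x
  proof -
    have "std_normal_density (c * x) = 1 / sqrt (2 * pi) * exp (- (p * x\<^sup>2))"
      by (simp add: std_normal_density_def power_mult_distrib c)
    moreover have "t * (c * x) = - (\<omega> * x)" using c by (simp add: t_def)
    moreover have "sqrt (2 * pi) \<noteq> 0" by simp
    ultimately show ?thesis
      by (simp add: exp_diff exp_minus exp_of_real [symmetric] scaleR_conv_of_real divide_inverse)
  qed
  show "integrable lborel (\<lambda>x. exp (- of_real (p * x\<^sup>2) - \<i> * of_real (\<omega> * x)) :: complex)"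
    unfolding eq using c by (intro integrable_scaleR_right lborel_integrable_real_affine[OF int]) auto
  have "(LINT x|lborel. exp (- of_real (p * x\<^sup>2) - \<i> * of_real (\<omega> * x)) :: complex)
      = sqrt (2 * pi) *\<^sub>R (LINT x|lborel. ?g (0 + c * x))"
    unfolding eq by (rule integral_scaleR_right)
  also have "(LINT x|lborel. ?g (0 + c * x)) = inverse c *\<^sub>R integral\<^sup>L lborel ?g"
    using lborel_integral_real_affine[of c ?g 0] c by simp
  also have "sqrt (2 * pi) *\<^sub>R (inverse c *\<^sub>R integral\<^sup>L lborel ?g)
      = of_real (sqrt (2 * pi) / c * exp (- (t\<^sup>2) / 2))"
    unfolding val by (simp only: scaleR_conv_of_real of_real_mult [symmetric] divide_inverse mult.assoc)
  also have "sqrt (2 * pi) / c = sqrt (pi / p)"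
    unfolding c_def by (subst real_sqrt_divide[symmetric]) simp
  also have "- (t\<^sup>2) / 2 = - (\<omega>\<^sup>2 / (4 * p))"
    by (simp add: t_def power_divide c)
  finally show "(LINT x|lborel. exp (- of_real (p * x\<^sup>2) - \<i> * of_real (\<omega> * x)) :: complex)
           = of_real (sqrt (pi / p) * exp (- (\<omega>\<^sup>2 / (4 * p))))" .
qed

text \<open>Lebesgue measure is the image of the product of one-dimensional Lebesgue measures under
  the coordinate map; this is what reduces Gaussians in any dimension to the real line.\<close>

lemma lborel_prod_Basis:
  fixes g :: "'a::euclidean_space \<Rightarrow> real \<Rightarrow> 'b::{real_normed_field,banach,second_countable_topology}"
  assumes "\<And>b. b \<in> Basis \<Longrightarrow> integrable lborel (g b)"
  shows "integrable lborel (\<lambda>x. \<Prod>b\<in>Basis. g b (x \<bullet> b))"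
    and "(LINT x|lborel. (\<Prod>b\<in>Basis. g b (x \<bullet> b))) = (\<Prod>b\<in>Basis. integral\<^sup>L lborel (g b))"
proof -
  interpret product_sigma_finite "\<lambda>b::'a. lborel :: real measure" ..
  have [measurable]: "g b \<in> borel_measurable borel" if "b \<in> Basis" for b
    using borel_measurable_integrable[OF assms[OF that]] by simp
  have m: "(\<lambda>x. \<Prod>b\<in>Basis. g b (x \<bullet> b)) \<in> borel_measurable borel"
    by measurable
  have s: "(\<lambda>f. \<Sum>b\<in>Basis. f b *\<^sub>R b :: 'a) \<in> measurable (\<Pi>\<^sub>M b\<in>(Basis :: 'a set). lborel) borel"
    by measurable
  have e: "(\<Prod>b\<in>Basis. g b ((\<Sum>b\<in>Basis. f b *\<^sub>R b) \<bullet> b)) = (\<Prod>b\<in>Basis. g b (f b))" for f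
    by (rule prod.cong) auto
  show "integrable lborel (\<lambda>x. \<Prod>b\<in>Basis. g b (x \<bullet> b))"
    by (subst lborel_eq, subst integrable_distr_eq[OF s m], unfold e, rule product_integrable_prod) (auto intro: assms)
  show "(LINT x|lborel. (\<Prod>b\<in>Basis. g b (x \<bullet> b))) = (\<Prod>b\<in>Basis. integral\<^sup>L lborel (g b))"
    by (subst lborel_eq, subst integral_distr[OF s m], unfold e, rule product_integral_prod) (auto intro: assms)
qed

lemma gaussian_fourier:
  fixes p :: real and w :: "'a::euclidean_space"
  assumes "p > 0"
  shows "integrable lborel (\<lambda>x. exp (- of_real (p * (norm x)\<^sup>2) - \<i> * of_real (w \<bullet> x)) :: complex)"
    and "(LINT x|lborel. exp (- of_real (p * (norm x)\<^sup>2) - \<i> * of_real (w \<bullet> x)) :: complex)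
           = of_real (sqrt (pi / p) ^ DIM('a) * exp (- ((norm w)\<^sup>2 / (4 * p))))"
proof -
  let ?g = "\<lambda>b y. exp (- of_real (p * y\<^sup>2) - \<i> * of_real ((w \<bullet> b) * y)) :: complex"
  have nrm: "(norm x)\<^sup>2 = (\<Sum>b\<in>Basis. (x \<bullet> b)\<^sup>2)" for x :: 'a
    unfolding power2_norm_eq_inner by (subst euclidean_inner) (simp add: power2_eq_square)
  have eq: "exp (- of_real (p * (norm x)\<^sup>2) - \<i> * of_real (w \<bullet> x)) = (\<Prod>b\<in>Basis. ?g b (x \<bullet> b))" for x :: 'a
    by (subst exp_sum[symmetric], simp, subst euclidean_inner)
       (simp add: nrm sum_distrib_left sum_subtractf sum_negf)
  show "integrable lborel (\<lambda>x. exp (- of_real (p * (norm x)\<^sup>2) - \<i> * of_real (w \<bullet> x)) :: complex)"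
    unfolding eq by (rule lborel_prod_Basis) (rule gaussian_fourier_real[OF assms])
  have "(LINT x|lborel. exp (- of_real (p * (norm x)\<^sup>2) - \<i> * of_real (w \<bullet> x)) :: complex)
      = (\<Prod>b\<in>Basis. integral\<^sup>L lborel (?g b))"
    unfolding eq by (rule lborel_prod_Basis) (rule gaussian_fourier_real[OF assms])
  also have "\<dots> = (\<Prod>b\<in>(Basis::'a set). of_real (sqrt (pi / p) * exp (- ((w \<bullet> b)\<^sup>2 / (4 * p)))))"
    by (intro prod.cong gaussian_fourier_real assms refl)
  also have "\<dots> = of_real (sqrt (pi / p) ^ DIM('a) * exp (- ((norm w)\<^sup>2 / (4 * p))))"
    by (simp add: prod.distrib nrm sum_divide_distrib sum_negf flip: of_real_prod exp_sum)
  finally show "(LINT x|lborel. exp (- of_real (p * (norm x)\<^sup>2) - \<i> * of_real (w \<bullet> x)) :: complex)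
           = of_real (sqrt (pi / p) ^ DIM('a) * exp (- ((norm w)\<^sup>2 / (4 * p))))" .
qed

lemma gaussian_integral:
  fixes p :: real
  assumes "p > 0"
  shows "integrable lborel (\<lambda>x::'a::euclidean_space. exp (- (p * (norm x)\<^sup>2)))"
    and "(LINT x|lborel. exp (- (p * (norm (x::'a))\<^sup>2))) = sqrt (pi / p) ^ DIM('a)"
proof -
  have eq: "exp (- of_real (p * (norm x)\<^sup>2) - \<i> * of_real (0 \<bullet> x)) = of_real (exp (- (p * (norm x)\<^sup>2)))" for x :: 'a
    by (simp flip: exp_of_real)
  show 1: "integrable lborel (\<lambda>x::'a. exp (- (p * (norm x)\<^sup>2)))"
    using gaussian_fourier(1)[OF assms, of "0::'a", unfolded eq] by (simp only: complex_of_real_integrable_eq)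
  show "(LINT x|lborel. exp (- (p * (norm (x::'a))\<^sup>2))) = sqrt (pi / p) ^ DIM('a)"
    using gaussian_fourier(2)[OF assms, of "0::'a", unfolded eq]
    by (simp add: integral_complex_of_real del: of_real_exp of_real_power of_real_mult)
qed

text \<open>Averaging \<open>D (x + \<theta> b)\<close> over \<open>0 \<le> \<theta> \<le> 1\<close> gives \<open>F (x + b) - F x\<close>, whose integral vanishes.\<close>
lemma integral_directional_derivative:
  fixes F D :: "'a::euclidean_space \<Rightarrow> complex"
  assumes F: "integrable lborel F" and D: "integrable lborel D"
    and cont: "continuous_on UNIV D"
    and deriv: "\<And>x \<theta>. ((\<lambda>\<theta>. F (x + \<theta> *\<^sub>R b)) has_vector_derivative D (x + \<theta> *\<^sub>R b)) (at \<theta>)"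
  shows "integral\<^sup>L lborel D = 0"
proof -
  have trI: "integrable lborel (\<lambda>x. f (x + c))" and tr: "(LINT x|lborel. f (x + c)) = integral\<^sup>L lborel f"
    if "integrable lborel f" for f :: "'a \<Rightarrow> 'b::{banach,second_countable_topology}" and c
  proof -
    have L: "lborel = distr lborel borel (\<lambda>x. x + c)"
      using lborel_distr_plus[of c] by (subst add.commute) simp
    have "integrable (distr lborel borel (\<lambda>x. x + c)) f" using that by (simp flip: L)
    then show "integrable lborel (\<lambda>x. f (x + c))" by (subst (asm) integrable_distr_eq) (use that in auto)
    show "(LINT x|lborel. f (x + c)) = integral\<^sup>L lborel f"
      by (subst (2) L, subst integral_distr) (use that in auto)
  qed
  \<comment> \<open>The cutoff in \<theta> makes \<open>f\<close> integrable on the product. Each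
    \<theta>-slice has the integral of \<open>D\<close> by translation invariance, and each x-slice
    is evaluated by the fundamental theorem of calculus. Boundary terms are thus handled by
    integrability of \<open>F\<close> alone, without a decay estimate.\<close>
  define f where "f = (\<lambda>(\<theta>::real, x). indicator {0..1} \<theta> *\<^sub>R D (x + \<theta> *\<^sub>R b))"
  have [measurable]: "D \<in> borel_measurable borel" "F \<in> borel_measurable borel"
    using F D borel_measurable_integrable by auto
  have int: "integrable (lborel \<Otimes>\<^sub>M lborel) f"
  proof (rule lborel_pair.Fubini_integrable)
    show "f \<in> borel_measurable (lborel \<Otimes>\<^sub>M lborel)" unfolding f_def by measurable
    have "(LINT y|lborel. norm (f (\<theta>, y))) = indicator {0..1} \<theta> *\<^sub>R (LINT y|lborel. norm (D y))" for \<theta>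
      using tr[of "\<lambda>x. norm (D x)" "\<theta> *\<^sub>R b"] D by (simp add: f_def)
    moreover have "integrable lborel (\<lambda>\<theta>::real. indicator {0..1} \<theta> *\<^sub>R (LINT y|lborel. norm (D y)))"
      by (intro integrable_scaleR_left) auto
    ultimately show "integrable lborel (\<lambda>x. LINT y|lborel. norm (f (x, y)))" by simp
    show "AE x in lborel. integrable lborel (\<lambda>y. f (x, y))"
      unfolding f_def using trI[OF D] by auto
  qed
  have "integral\<^sup>L lborel D = (LINT \<theta>|lborel. indicator {0..1::real} \<theta> *\<^sub>R integral\<^sup>L lborel D)"
    by simp
  also have "\<dots> = (LINT \<theta>|lborel. LINT x|lborel. f (\<theta>, x))"
    using tr[OF D] by (simp add: f_def)
  also have "\<dots> = (LINT x|lborel. LINT \<theta>|lborel. f (\<theta>, x))"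
    using lborel_pair.Fubini_integral[of "\<lambda>\<theta> x. f (\<theta>, x)"] int by simp
  also have "\<dots> = (LINT x|lborel. F (x + b) - F x)"
  proof (rule Bochner_Integration.integral_cong[OF refl])
    fix x
    have "(LINT \<theta>|lborel. indicator {0..1} \<theta> *\<^sub>R D (x + \<theta> *\<^sub>R b)) = F (x + 1 *\<^sub>R b) - F (x + 0 *\<^sub>R b)"
      by (rule integral_FTC_atLeastAtMost)
         (auto intro!: has_vector_derivative_at_within deriv continuous_intros continuous_on_compose2[OF cont])
    then show "(LINT \<theta>|lborel. f (\<theta>, x)) = F (x + b) - F x" by (simp add: f_def)
  qed
  also have "\<dots> = 0"
    using tr[OF F, of b] trI[OF F, of b] F by simp
  finally show ?thesis .
qed

section \<open>Polynomial moments of complex Gaussians\<close>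

lemma power_exp_bound:
  fixes x :: real assumes "x \<ge> 0" shows "x ^ n * exp (- x) \<le> fact n"
proof -
  have "x ^ n / fact n \<le> exp x"
  proof -
    \<comment> \<open>A single term of the exponential series is at most the whole sum.\<close>
    have "summable (\<lambda>n. x ^ n /\<^sub>R fact n)" by (rule summable_exp_generic)
    then have "(\<Sum>k\<in>{n}. x ^ k /\<^sub>R fact k) \<le> exp x"
      unfolding exp_def by (rule sum_le_suminf) (use assms in auto)
    then show ?thesis by (simp add: divide_inverse mult.commute)
  qed
  then show ?thesis by (simp add: exp_minus field_simps)
qed

text \<open>Half of the Gaussian is spent on absorbing the polynomial factor, after
  \<open>norm z ^ \<alpha>\<close> has been bounded by 1 plus a power of
  \<open>(norm z)\<^sup>2\<close>. The dependence on \<open>p\<close> is kept explicit because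
  \<open>p\<close> later varies with the integration variable of Schlaefli's integral.\<close>

lemma complex_gaussian_moment_bound:
  fixes p :: real and z :: complex
  assumes "p > 0"
  shows "norm (z ^ \<alpha> * exp (- of_real (p * (norm z)\<^sup>2) - \<i> * of_real (w \<bullet> z)))
      \<le> (1 + fact \<alpha> * (2 / p) ^ \<alpha>) * exp (- (p / 2 * (norm z)\<^sup>2))"
proof -
  let ?y = "(norm z)\<^sup>2"
  have "norm z ^ \<alpha> \<le> 1 + ?y ^ \<alpha>"
  proof (cases "norm z \<le> 1")
    case True then show ?thesis by (simp add: power_le_one add_increasing2)
  next
    case False
    then have "norm z ^ \<alpha> \<le> norm z ^ (2 * \<alpha>)" by (intro power_increasing) auto
    then show ?thesis by (simp add: power_mult)
  qed
  then have "norm z ^ \<alpha> * exp (- (p * ?y)) \<le> (1 + ?y ^ \<alpha>) * exp (- (p * ?y))"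
    by (rule mult_right_mono) simp
  also have "\<dots> = exp (- (p * ?y)) + (2 / p) ^ \<alpha> * (((p / 2 * ?y) ^ \<alpha> * exp (- (p / 2 * ?y))) * exp (- (p / 2 * ?y)))"
    using assms by (simp add: distrib_right power_mult_distrib power_divide mult.assoc flip: exp_add)
  also have "\<dots> \<le> exp (- (p / 2 * ?y)) + (2 / p) ^ \<alpha> * (fact \<alpha> * exp (- (p / 2 * ?y)))"
    using assms by (intro add_mono mult_left_mono mult_right_mono power_exp_bound) auto
  also have "\<dots> = (1 + fact \<alpha> * (2 / p) ^ \<alpha>) * exp (- (p / 2 * ?y))"
    by (simp add: algebra_simps)
  finally show ?thesis by (simp add: norm_mult norm_power)
qed

lemma complex_gaussian_moment_integrable:
  fixes p :: real and w :: complex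
  assumes "p > 0"
  shows "integrable lborel (\<lambda>z. z ^ \<alpha> * exp (- of_real (p * (norm z)\<^sup>2) - \<i> * of_real (w \<bullet> z)))"
proof (rule Bochner_Integration.integrable_bound)
  show "integrable lborel (\<lambda>z::complex. (1 + fact \<alpha> * (2 / p) ^ \<alpha>) * exp (- (p / 2 * (norm z)\<^sup>2)))"
    using assms by (intro integrable_mult_right gaussian_integral) auto
  show "(\<lambda>z. z ^ \<alpha> * exp (- of_real (p * (norm z)\<^sup>2) - \<i> * of_real (w \<bullet> z))) \<in> borel_measurable lborel"
    by (subst measurable_lborel2) (intro borel_measurable_continuous_onI continuous_intros)
  show "AE z in lborel. norm (z ^ \<alpha> * exp (- of_real (p * (norm z)\<^sup>2) - \<i> * of_real (w \<bullet> z)))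
      \<le> norm ((1 + fact \<alpha> * (2 / p) ^ \<alpha>) * exp (- (p / 2 * (norm z)\<^sup>2)))"
    using complex_gaussian_moment_bound[OF assms] by (intro AE_I2) (metis abs_ge_self order_trans real_norm_def)
qed

text \<open>Integration by parts against \<open>\<partial>/\<partial>cnj z\<close>: \<open>z\<close> times the Gaussian is such a derivative, and
  \<open>z ^ \<alpha>\<close> is holomorphic.\<close>
lemma complex_gaussian_moment_Suc:
  fixes p :: real and w :: complex
  assumes p: "p > 0"
  defines "J \<equiv> \<lambda>\<alpha>. LINT z|lborel. z ^ \<alpha> * exp (- of_real (p * (norm z)\<^sup>2) - \<i> * of_real (w \<bullet> z))"
  shows "J (Suc \<alpha>) = - \<i> * w / (2 * of_real p) * J \<alpha>"
proof -
  let ?E = "\<lambda>z::complex. exp (- of_real (p * (norm z)\<^sup>2) - \<i> * of_real (w \<bullet> z))"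
  let ?F = "\<lambda>z. z ^ \<alpha> * ?E z"
  \<comment> \<open>The derivative of \<open>?F\<close> in the direction \<open>b\<close>; the
    directions 1 and \<i> give the two real partial derivatives.\<close>
  let ?D = "\<lambda>b z. of_nat \<alpha> * b * (z ^ (\<alpha> - 1) * ?E z)
              + (- of_real (2 * p * (z \<bullet> b)) - \<i> * of_real (w \<bullet> b)) * (z ^ \<alpha> * ?E z)"
  note int = complex_gaussian_moment_integrable[OF p, of _ w]
  have intb: "integrable lborel (\<lambda>z. of_real (2 * p * (z \<bullet> b)) * ?F z)" if "norm b = 1" for b
  proof (rule Bochner_Integration.integrable_bound[OF integrable_mult_right[OF int[of "Suc \<alpha>"], of "of_real (2 * p)"]])
    show "AE z in lborel. norm (of_real (2 * p * (z \<bullet> b)) * ?F z) \<le> norm (of_real (2 * p) * (z ^ Suc \<alpha> * ?E z))"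
    proof (intro AE_I2)
      fix z :: complex
      have "\<bar>z \<bullet> b\<bar> \<le> norm z" using Cauchy_Schwarz_ineq2[of z b] that by simp
      then have "\<bar>z \<bullet> b\<bar> * (norm z ^ \<alpha> * norm (?E z)) \<le> norm z * (norm z ^ \<alpha> * norm (?E z))"
        by (rule mult_right_mono) simp
      then show "norm (of_real (2 * p * (z \<bullet> b)) * ?F z) \<le> norm (of_real (2 * p) * (z ^ Suc \<alpha> * ?E z))"
        using p by (simp add: norm_mult norm_power abs_mult mult.assoc)
    qed
    show "(\<lambda>z. of_real (2 * p * (z \<bullet> b)) * ?F z) \<in> borel_measurable lborel"
      by (subst measurable_lborel2) (intro borel_measurable_continuous_onI continuous_intros)
  qed
  have intD: "integrable lborel (?D b)" if "norm b = 1" for b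
    using intb[OF that] int by (simp add: left_diff_distrib del: of_real_mult mult_minus_left)
  have zero: "integral\<^sup>L lborel (?D b) = 0" if b: "norm b = 1" for b
  proof (rule integral_directional_derivative[where F = ?F and b = b])
    show "integrable lborel ?F" by (rule int)
    show "integrable lborel (?D b)" using intD[OF b] .
    show "continuous_on UNIV (?D b)" by (intro continuous_intros)
    fix x :: complex and \<theta> :: real
    show "((\<lambda>\<theta>. ?F (x + \<theta> *\<^sub>R b)) has_vector_derivative ?D b (x + \<theta> *\<^sub>R b)) (at \<theta>)"
    proof -
      define y where "y = x + \<theta> *\<^sub>R b"
      have line: "((\<lambda>\<theta>. x + \<theta> *\<^sub>R b) has_vector_derivative b) (at \<theta>)"
        by (auto intro!: derivative_eq_intros)
      have pow: "((\<lambda>\<theta>. (x + \<theta> *\<^sub>R b) ^ \<alpha>) has_vector_derivative b * (of_nat \<alpha> * y ^ (\<alpha> - 1))) (at \<theta>)"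
      proof -
        have "((\<lambda>z. z ^ \<alpha>) has_field_derivative of_nat \<alpha> * y ^ (\<alpha> - 1)) (at y)"
          by (auto intro!: derivative_eq_intros)
        then show ?thesis using field_vector_diff_chain_at[OF line] unfolding o_def y_def by blast
      qed
      have r1: "((\<lambda>\<theta>. p * (norm (x + \<theta> *\<^sub>R b))\<^sup>2) has_vector_derivative 2 * p * (y \<bullet> b)) (at \<theta>)"
        unfolding power2_norm_eq_inner has_vector_derivative_def y_def
        by (rule derivative_eq_intros refl)+
           (auto simp: fun_eq_iff algebra_simps inner_commute)
      have r2: "((\<lambda>\<theta>. w \<bullet> (x + \<theta> *\<^sub>R b)) has_vector_derivative w \<bullet> b) (at \<theta>)"
        unfolding has_vector_derivative_def
        by (rule derivative_eq_intros refl)+ (auto simp: fun_eq_iff algebra_simps)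
      have ex: "((\<lambda>\<theta>. - of_real (p * (norm (x + \<theta> *\<^sub>R b))\<^sup>2) - \<i> * of_real (w \<bullet> (x + \<theta> *\<^sub>R b)))
          has_vector_derivative - complex_of_real (2 * p * (y \<bullet> b)) - \<i> * of_real (w \<bullet> b)) (at \<theta>)"
        by (intro has_vector_derivative_diff has_vector_derivative_minus has_vector_derivative_mult_right
              has_vector_derivative_of_real r1[folded has_real_derivative_iff_has_vector_derivative]
              r2[folded has_real_derivative_iff_has_vector_derivative])
      have "((\<lambda>\<theta>. ?E (x + \<theta> *\<^sub>R b)) has_vector_derivative
          (- complex_of_real (2 * p * (y \<bullet> b)) - \<i> * of_real (w \<bullet> b)) * ?E y) (at \<theta>)"
        using field_vector_diff_chain_at[OF ex, of exp "?E y"] unfolding y_def o_def by (auto intro!: DERIV_exp)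
      from has_vector_derivative_mult[OF pow this]
      show ?thesis unfolding y_def[symmetric]
        by (rule has_vector_derivative_eq_rhs) (simp add: algebra_simps y_def)
    qed
  qed
  \<comment> \<open>This combination of the two partial derivatives is twice the derivative by
    \<open>cnj z\<close>. The terms coming from \<open>z ^ \<alpha>\<close> carry the factor 1 +
    \<i> * \<i> = 0 and drop out.\<close>
  have "0 = integral\<^sup>L lborel (?D 1) + \<i> * integral\<^sup>L lborel (?D \<i>)"
    by (subst (1 2) zero) auto
  also have "\<dots> = (LINT z|lborel. ?D 1 z + \<i> * ?D \<i> z)"
    using intD[of 1] intD[of \<i>] by (subst Bochner_Integration.integral_add) auto
  also have "\<dots> = (LINT z|lborel. - of_real (2 * p) * (z ^ Suc \<alpha> * ?E z) + (- \<i> * w) * ?F z)"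
  proof (rule Bochner_Integration.integral_cong[OF refl])
    fix z :: complex
    have "z = of_real (Re z) + \<i> * of_real (Im z)" "w = of_real (Re w) + \<i> * of_real (Im w)"
      by (simp_all add: complex_eq)
    then have zw: "(- of_real (2 * p * Re z) - \<i> * of_real (Re w)) + \<i> * (- of_real (2 * p * Im z) - \<i> * of_real (Im w))
       = - of_real (2 * p) * z + (- \<i> * w)"
      by (simp add: complex_eq_iff)
    have "?D 1 z + \<i> * ?D \<i> z = ((- of_real (2 * p * Re z) - \<i> * of_real (Re w)) + \<i> * (- of_real (2 * p * Im z) - \<i> * of_real (Im w))) * ?F z"
      by (simp add: algebra_simps inner_complex_def)
    then show "?D 1 z + \<i> * ?D \<i> z = - of_real (2 * p) * (z ^ Suc \<alpha> * ?E z) + (- \<i> * w) * ?F z"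
      unfolding zw by (simp add: algebra_simps)
  qed
  also have "\<dots> = - of_real (2 * p) * J (Suc \<alpha>) + (- \<i> * w) * J \<alpha>"
    unfolding J_def using int[of "Suc \<alpha>"] int[of \<alpha>]
    by (subst Bochner_Integration.integral_add) (auto simp del: power_Suc)
  finally show ?thesis using p by (simp add: field_simps)
qed

lemma complex_gaussian_moment:
  fixes p :: real and w :: complex
  assumes p: "p > 0"
  shows "(LINT z|lborel. z ^ \<alpha> * exp (- of_real (p * (norm z)\<^sup>2) - \<i> * of_real (w \<bullet> z)))
     = of_real (pi / p) * (- \<i> * w / (2 * of_real p)) ^ \<alpha> * exp (- of_real ((norm w)\<^sup>2 / (4 * p)))"
proof (induction \<alpha>)
  case 0
  show ?case using gaussian_fourier(2)[OF p, of w] p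
    by (simp flip: exp_of_real)
next
  case (Suc \<alpha>)
  show ?case unfolding complex_gaussian_moment_Suc[OF p] Suc by (simp add: mult_ac)
qed

subsection \<open>Schlaefli's integral\<close>

text \<open>Euler's integral after t = exp x. On the whole line, powers of t become exponentials
  without any branch of the logarithm, and scalings of t become translations.\<close>

lemma Gamma_exp_integral:
  fixes z :: complex
  assumes "Re z > 0"
  shows "integrable lborel (\<lambda>x. exp (z * of_real x - of_real (exp x)))"
    and "(LINT x|lborel. exp (z * of_real x - of_real (exp x))) = Gamma z"
proof -
  let ?f = "\<lambda>t. complex_of_real t powr (z - 1) / of_real (exp t)"
  let ?g = "\<lambda>x. exp (z * of_real x - of_real (exp x)) :: complex"
  have eq: "\<bar>exp x\<bar> *\<^sub>R ?f (exp x) = ?g x" for x :: real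
  proof -
    have "Ln (complex_of_real (exp x)) = of_real x"
      using Ln_of_real[of "exp x"] by simp
    then have "complex_of_real (exp x) powr (z - 1) = exp ((z - 1) * of_real x)"
      by (simp add: powr_def)
    then show ?thesis
      by (simp add: scaleR_conv_of_real exp_diff left_diff_distrib exp_of_real [symmetric])
  qed
  have img: "range (exp :: real \<Rightarrow> real) = {0<..}"
    by (auto simp: image_iff) (metis exp_ln)
  have "(\<lambda>x. \<bar>exp x\<bar> *\<^sub>R ?f (exp x)) absolutely_integrable_on UNIV \<and> integral UNIV (\<lambda>x. \<bar>exp x\<bar> *\<^sub>R ?f (exp x)) = Gamma z
     \<longleftrightarrow> ?f absolutely_integrable_on (exp ` UNIV) \<and> integral (exp ` UNIV) ?f = Gamma z"
    by (rule has_absolute_integral_change_of_variables_real)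
       (auto intro!: derivative_eq_intros inj_onI)
  then have g: "?g absolutely_integrable_on UNIV" "integral UNIV ?g = Gamma z"
    unfolding eq img using absolutely_integrable_Gamma_integral'[OF assms] Gamma_integral_complex'[OF assms]
    by (auto simp: integral_unique)
  have meas: "?g \<in> borel_measurable lborel"
    by (subst measurable_lborel2) (intro borel_measurable_continuous_onI continuous_intros)
  \<comment> \<open>Absolute integrability on \<open>UNIV\<close> refers to the completed measure;
    Borel measurability brings it back to \<open>lborel\<close>.\<close>
  have "integrable lebesgue ?g" using g(1) by (simp add: set_integrable_def)
  then show int: "integrable lborel ?g" using integrable_completion[OF meas] by simp
  show "integral\<^sup>L lborel ?g = Gamma z"
    using g has_integral_integral_lborel[OF int] by (auto dest: integral_unique)
qed

text \<open>Multiplying t by \<open>X\<close> is the translation of x by \<open>ln X\<close>. Read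
  from right to left, this writes the inverse power in \<open>G_fun\<close> as a superposition of
  exponentials of \<open>X\<close>.\<close>

lemma exp_shift_integral:
  fixes a :: complex and X :: real
  assumes a: "Re a > 0" and X: "X > 0"
  shows "integrable lborel (\<lambda>x. exp (a * of_real x - of_real (X * exp x)))"
    and "(LINT x|lborel. exp (a * of_real x - of_real (X * exp x))) = Gamma a / of_real X powr a"
proof -
  have eq: "exp (a * of_real x - of_real (X * exp x))
      = exp (- a * of_real (ln X)) * (\<lambda>x. exp (a * of_real x - of_real (exp x))) (ln X + 1 * x)" for x
    using X by (simp add: exp_add algebra_simps flip: exp_of_real) (simp flip: exp_add exp_of_real)
  show "integrable lborel (\<lambda>x. exp (a * of_real x - of_real (X * exp x)))"
    unfolding eq by (intro integrable_mult_right lborel_integrable_real_affine Gamma_exp_integral a) auto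
  have "(LINT x|lborel. exp (a * of_real x - of_real (X * exp x))) = exp (- a * of_real (ln X)) * Gamma a"
    unfolding eq integral_mult_right_zero
    using lborel_integral_real_affine[of 1 "\<lambda>x. exp (a * of_real x - of_real (exp x))" "ln X"] Gamma_exp_integral(2)[OF a]
    by simp
  also have "exp (- a * of_real (ln X)) * Gamma a = Gamma a / of_real X powr a"
    using X by (simp add: powr_def exp_minus field_simps flip: Ln_of_real)
  finally show "(LINT x|lborel. exp (a * of_real x - of_real (X * exp x))) = Gamma a / of_real X powr a" .
qed

text \<open>The kernel of \<open>2 (C / A) powr (\<nu> / 2) * K \<nu> (2 sqrt (A C))\<close>, that is
  \<open>t powr (\<nu> - 1) * exp (- A t - C / t)\<close>, after the substitution \<open>t = exp x\<close>.\<close>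
definition schlaefli_kernel :: "complex \<Rightarrow> real \<Rightarrow> real \<Rightarrow> real \<Rightarrow> complex" where
  "schlaefli_kernel \<nu> A C x = exp (\<nu> * of_real x - of_real (A * exp x + C * exp (- x)))"

definition schlaefli :: "complex \<Rightarrow> real \<Rightarrow> real \<Rightarrow> complex" where
  "schlaefli \<nu> A C = (LINT x|lborel. schlaefli_kernel \<nu> A C x)"

lemma norm_schlaefli_kernel:
  "norm (schlaefli_kernel \<nu> A C x) = exp (Re \<nu> * x - (A * exp x + C * exp (- x)))"
  by (simp add: schlaefli_kernel_def)

lemma schlaefli_kernel_add_1: "schlaefli_kernel (\<nu> + 1) A C x = of_real (exp x) * schlaefli_kernel \<nu> A C x"
  unfolding schlaefli_kernel_def exp_of_real[symmetric] exp_add[symmetric] by (simp add: algebra_simps)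

lemma schlaefli_kernel_diff_1: "schlaefli_kernel (\<nu> - 1) A C x = of_real (exp (- x)) * schlaefli_kernel \<nu> A C x"
  unfolding schlaefli_kernel_def exp_of_real[symmetric] exp_add[symmetric] by (simp add: algebra_simps)

lemma schlaefli_kernel_measurable [measurable]: "schlaefli_kernel \<nu> A C \<in> borel_measurable borel"
  unfolding schlaefli_kernel_def [abs_def]
  by (intro borel_measurable_continuous_onI continuous_intros)

text \<open>Near t = 0, that is for x tending to minus infinity, the factor exp (- C / t) beats
  every power of t; the free \<open>n\<close> allows any order to be raised into the domain of the
  Gamma integral.\<close>

lemma exp_neg_exp_bound:
  fixes C x :: real assumes "C > 0"
  shows "exp (- (C * exp (- x))) \<le> fact n / C ^ n * exp (of_nat n * x)"
proof -
  have "(C * exp (- x)) ^ n * exp (- (C * exp (- x))) \<le> fact n"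
    using assms by (intro power_exp_bound) simp
  moreover have "(C * exp (- x)) ^ n = C ^ n * exp (- (of_nat n * x))"
    by (simp add: power_mult_distrib flip: exp_of_nat_mult)
  ultimately show ?thesis using assms
    by (simp add: exp_minus field_simps)
qed

lemma schlaefli_integrable:
  assumes A: "A > 0" and C: "C > 0"
  shows "integrable lborel (schlaefli_kernel \<nu> A C)"
proof -
  \<comment> \<open>Chosen so that \<nu> + n has positive real part: the kernel is then dominated by
    a Gamma integrand.\<close>
  obtain n :: nat where n: "of_nat n > - Re \<nu>" using reals_Archimedean2 by blast
  show ?thesis
  proof (rule Bochner_Integration.integrable_bound)
    show "integrable lborel (\<lambda>x. of_real (fact n / C ^ n) * exp ((\<nu> + of_nat n) * of_real x - of_real (A * exp x)))"
      using n A by (intro integrable_mult_right exp_shift_integral) auto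
    show "AE x in lborel. norm (schlaefli_kernel \<nu> A C x)
        \<le> norm (of_real (fact n / C ^ n) * exp ((\<nu> + of_nat n) * of_real x - of_real (A * exp x)) :: complex)"
    proof (rule AE_I2)
      fix x :: real
      have "norm (schlaefli_kernel \<nu> A C x) = exp (Re \<nu> * x - A * exp x) * exp (- (C * exp (- x)))"
        by (simp add: norm_schlaefli_kernel flip: exp_add)
      also have "\<dots> \<le> exp (Re \<nu> * x - A * exp x) * (fact n / C ^ n * exp (of_nat n * x))"
        by (intro mult_left_mono exp_neg_exp_bound C) simp
      also have "\<dots> = norm (of_real (fact n / C ^ n) * exp ((\<nu> + of_nat n) * of_real x - of_real (A * exp x)) :: complex)"
        using C by (simp add: norm_mult algebra_simps exp_add norm_divide norm_power exp_diff)
      finally show "norm (schlaefli_kernel \<nu> A C x) \<le> norm (of_real (fact n / C ^ n) * exp ((\<nu> + of_nat n) * of_real x - of_real (A * exp x)) :: complex)" .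
    qed
  qed simp
qed

text \<open>Translation by \<open>ln A\<close> normalises the first coefficient to 1, leaving a
  function of the product \<open>A * C\<close> only.\<close>

lemma schlaefli_scale:
  assumes A: "A > 0" and C: "C > 0"
  shows "schlaefli \<nu> A C = exp (- \<nu> * of_real (ln A)) * schlaefli \<nu> 1 (A * C)"
proof -
  have eq: "schlaefli_kernel \<nu> 1 (A * C) (ln A + 1 * x) = exp (\<nu> * of_real (ln A)) * schlaefli_kernel \<nu> A C x" for x
  proof -
    have "1 * exp (ln A + 1 * x) + A * C * exp (- (ln A + 1 * x)) = A * exp x + C * exp (- x)"
      using A by (simp add: exp_add exp_minus exp_diff field_simps)
    then show ?thesis
      unfolding schlaefli_kernel_def by (simp only:) (simp add: algebra_simps flip: exp_add)
  qed
  have "schlaefli \<nu> 1 (A * C) = exp (\<nu> * of_real (ln A)) * schlaefli \<nu> A C"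
    using lborel_integral_real_affine[of 1 "schlaefli_kernel \<nu> 1 (A * C)" "ln A"]
    unfolding eq by (simp add: schlaefli_def)
  then show ?thesis by (simp add: exp_minus)
qed

text \<open>Reflection of the line, or t replaced by 1 / t. In terms of K this is evenness in the
  order.\<close>

lemma schlaefli_uminus:
  "schlaefli (- \<nu>) A C = schlaefli \<nu> C A"
proof -
  have "schlaefli_kernel (- \<nu>) A C (0 + (- 1) * x) = schlaefli_kernel \<nu> C A x" for x
    by (simp add: schlaefli_kernel_def add.commute)
  then show ?thesis
    using lborel_integral_real_affine[of "-1" "schlaefli_kernel (- \<nu>) A C" 0] by (simp add: schlaefli_def)
qed

text \<open>The left-hand side is the integral over the line of the x-derivative of the kernel. It
  amounts to the three-term recurrence of K.\<close>

lemma schlaefli_recurrence: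
  assumes A: "A > 0" and C: "C > 0"
  shows "\<nu> * schlaefli \<nu> A C - of_real A * schlaefli (\<nu> + 1) A C + of_real C * schlaefli (\<nu> - 1) A C = 0"
proof -
  let ?k = "\<lambda>\<mu>. schlaefli_kernel \<mu> A C"
  let ?D = "\<lambda>x. \<nu> * ?k \<nu> x - of_real A * ?k (\<nu> + 1) x + of_real C * ?k (\<nu> - 1) x"
  note int = schlaefli_integrable[OF A C]
  have D: "?D x = (\<nu> - of_real (A * exp x) + of_real (C * exp (- x))) * ?k \<nu> x" for x
    unfolding schlaefli_kernel_add_1 schlaefli_kernel_diff_1 by (simp add: algebra_simps)
  have "integral\<^sup>L lborel ?D = 0"
  proof (rule integral_directional_derivative[where F = "?k \<nu>" and b = 1])
    show "integrable lborel ?D" using int by auto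
    show "continuous_on UNIV ?D" unfolding schlaefli_kernel_def by (intro continuous_intros)
    fix x \<theta> :: real
    define y where "y = x + \<theta>"
    have "((\<lambda>\<theta>. \<nu> * of_real (x + \<theta>) - of_real (A * exp (x + \<theta>) + C * exp (- (x + \<theta>)))) has_vector_derivative
        \<nu> * of_real 1 - of_real (A * exp y - C * exp (- y))) (at \<theta>)"
      unfolding y_def
      by (intro has_vector_derivative_diff has_vector_derivative_mult_right has_vector_derivative_of_real)
         (auto intro!: derivative_eq_intros simp flip: has_real_derivative_iff_has_vector_derivative)
    from field_vector_diff_chain_at[OF this, of exp "?k \<nu> y"]
    show "((\<lambda>\<theta>. ?k \<nu> (x + \<theta> *\<^sub>R 1)) has_vector_derivative ?D (x + \<theta> *\<^sub>R 1)) (at \<theta>)"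
      unfolding D unfolding schlaefli_kernel_def y_def o_def
      by (auto intro!: DERIV_exp elim!: has_vector_derivative_eq_rhs simp: algebra_simps)
  qed (rule int)
  then show ?thesis using int by (simp add: schlaefli_def)
qed

subsection \<open>Modified Bessel functions\<close>

text \<open>The Bessel function I at 2 sqrt z, divided by z to the power \<nu> / 2. Without that
  power the function is entire in z and can be evaluated at 0, and differentiation only shifts
  \<nu>.\<close>

definition bessel_series :: "complex \<Rightarrow> complex \<Rightarrow> complex" where
  "bessel_series \<nu> z = (\<Sum>k. rGamma (of_nat k + 1) * rGamma (of_nat k + \<nu> + 1) * z ^ k)"

lemma bessel_series_summable:
  "summable (\<lambda>k. rGamma (of_nat k + 1) * rGamma (of_nat k + \<nu> + 1) * z ^ k :: complex)"
proof -
  let ?f = "\<lambda>k. rGamma (of_nat k + 1) * rGamma (of_nat k + \<nu> + 1) * z ^ k"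
  \<comment> \<open>Consecutive coefficients differ by the factor (n + 1) (n + \<nu> + 1). From
    \<open>N\<close> on its first part has modulus at least 2 * norm z and its second at least 1, so
    each term is at most half the one before. The relation
    \<open>rGamma x = x * rGamma (x + 1)\<close> is used instead of quotients, since early terms may
    vanish.\<close>
  obtain N :: nat where N: "of_nat N \<ge> norm \<nu> + 2 * norm z" using real_arch_simple by blast
  show ?thesis
  proof (rule summable_ratio_test[where c = "1/2" and N = N])
    fix n assume "n \<ge> N"
    then have n: "of_nat n \<ge> norm \<nu> + 2 * norm z" using N by (simp add: order_trans)
    let ?q = "(of_nat n + 1) * (of_nat n + \<nu> + 1) :: complex"
    have "norm (of_nat n + \<nu> + 1 :: complex) \<ge> norm (of_nat n + 1 :: complex) - norm \<nu>"
      using norm_diff_ineq[of "of_nat n + 1 :: complex" \<nu>] by (simp add: ac_simps)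
    moreover have n1: "norm (of_nat n + 1 :: complex) = of_nat n + 1"
      by (metis norm_of_nat of_nat_Suc add.commute)
    ultimately have n2: "norm (of_nat n + \<nu> + 1 :: complex) \<ge> 1" using n norm_ge_zero[of z] by linarith
    have "of_nat n + 1 \<ge> 2 * norm z" using n norm_ge_zero[of \<nu>] by linarith
    then have q: "norm ?q \<ge> 2 * norm z * 1" unfolding norm_mult n1
      using n2 by (intro mult_mono) auto
    have "?f n = ?q * (rGamma (of_nat (Suc n) + 1) * rGamma (of_nat (Suc n) + \<nu> + 1)) * z ^ n"
    proof -
      have "rGamma (of_nat n + 1) = (of_nat n + 1) * rGamma (of_nat (Suc n) + 1 :: complex)"
        "rGamma (of_nat n + \<nu> + 1) = (of_nat n + \<nu> + 1) * rGamma (of_nat (Suc n) + \<nu> + 1)"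
        using rGamma_plus1[of "of_nat n + 1 :: complex"] rGamma_plus1[of "of_nat n + \<nu> + 1"] by (simp_all add: add_ac)
      then show ?thesis by (simp only: mult_ac)
    qed
    then have "norm (?f n) = norm ?q * (norm (rGamma (of_nat (Suc n) + 1) * rGamma (of_nat (Suc n) + \<nu> + 1)) * norm z ^ n)"
      by (simp only: norm_mult norm_power mult_ac)
    also have "\<dots> \<ge> 2 * norm z * 1 * (norm (rGamma (of_nat (Suc n) + 1) * rGamma (of_nat (Suc n) + \<nu> + 1)) * norm z ^ n)"
      by (rule mult_right_mono[OF q]) simp
    finally show "norm (?f (Suc n)) \<le> 1/2 * norm (?f n)"
      by (simp add: norm_mult norm_power mult_ac)
  qed simp
qed

lemma bessel_series_0: "bessel_series \<nu> 0 = rGamma (\<nu> + 1)"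
proof -
  have "bessel_series \<nu> 0 = (\<Sum>k. (rGamma (of_nat k + 1) * rGamma (of_nat k + \<nu> + 1)) * 0 ^ k)"
    by (simp add: bessel_series_def)
  also have "\<dots> = rGamma (\<nu> + 1)" by (subst powser_zero) (simp add: rGamma_inverse_Gamma)
  finally show ?thesis .
qed

text \<open>The factor k + 1 produced by differentiation is absorbed by the reciprocal factorial, so
  the derivative is the series of order \<nu> + 1.\<close>

lemma bessel_series_diffs:
  "diffs (\<lambda>k. rGamma (of_nat k + 1) * rGamma (of_nat k + \<nu> + 1) :: complex)
    = (\<lambda>k. rGamma (of_nat k + 1) * rGamma (of_nat k + (\<nu> + 1) + 1))"
proof
  fix k
  show "diffs (\<lambda>k. rGamma (of_nat k + 1) * rGamma (of_nat k + \<nu> + 1)) k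
     = (rGamma (of_nat k + 1) * rGamma (of_nat k + (\<nu> + 1) + 1) :: complex)"
  proof -
    have "rGamma (of_nat k + 1) = (of_nat k + 1) * rGamma (of_nat (Suc k) + 1 :: complex)"
      using rGamma_plus1[of "of_nat k + 1 :: complex"] by (simp add: add_ac)
    then show ?thesis by (simp add: diffs_def add_ac)
  qed
qed

lemma bessel_series_deriv:
  "(bessel_series \<nu> has_field_derivative bessel_series (\<nu> + 1) z) (at z)"
  using termdiffs_strong_converges_everywhere[OF bessel_series_summable, of \<nu> z]
  unfolding bessel_series_diffs by (simp add: bessel_series_def [abs_def])

text \<open>Multiplying the derivative by z multiplies the k-th coefficient by k, and (k + \<nu>) *
  rGamma (k + \<nu> + 1) = rGamma (k + \<nu>).\<close>

lemma bessel_series_recurrence: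
  "z * bessel_series (\<nu> + 1) z + \<nu> * bessel_series \<nu> z = bessel_series (\<nu> - 1) z"
proof -
  let ?a = "\<lambda>k. rGamma (of_nat k + 1) * rGamma (of_nat k + \<nu> + 1) :: complex"
  have "(\<lambda>k. z * (diffs ?a k * z ^ k)) sums (z * bessel_series (\<nu> + 1) z)"
    unfolding bessel_series_diffs bessel_series_def by (intro sums_mult summable_sums bessel_series_summable)
  then have "(\<lambda>k. of_nat (Suc k) * ?a (Suc k) * z ^ Suc k) sums (z * bessel_series (\<nu> + 1) z)"
    by (simp add: diffs_def mult_ac)
  then have "(\<lambda>k. of_nat k * ?a k * z ^ k) sums (z * bessel_series (\<nu> + 1) z)"
    by (subst (asm) sums_Suc_iff) simp
  moreover have "(\<lambda>k. \<nu> * (?a k * z ^ k)) sums (\<nu> * bessel_series \<nu> z)"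
    unfolding bessel_series_def by (intro sums_mult summable_sums bessel_series_summable)
  ultimately have "(\<lambda>k. of_nat k * ?a k * z ^ k + \<nu> * (?a k * z ^ k)) sums (z * bessel_series (\<nu> + 1) z + \<nu> * bessel_series \<nu> z)"
    by (rule sums_add)
  also have "(\<lambda>k. of_nat k * ?a k * z ^ k + \<nu> * (?a k * z ^ k)) = (\<lambda>k. rGamma (of_nat k + 1) * rGamma (of_nat k + (\<nu> - 1) + 1) * z ^ k)"
  proof
    fix k
    show "of_nat k * ?a k * z ^ k + \<nu> * (?a k * z ^ k) = rGamma (of_nat k + 1) * rGamma (of_nat k + (\<nu> - 1) + 1) * z ^ k"
      using rGamma_plus1[of "of_nat k + \<nu>"] by (simp add: distrib_right [symmetric] mult_ac)
  qed
  finally show ?thesis by (simp add: bessel_series_def sums_iff)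
qed

text \<open>The Wronskian of the Bessel functions I of orders \<nu> and - \<nu>, freed of powers of
  z. Its z-derivative vanishes by the recurrences; at z = 0 only
  \<open>rGamma \<nu> * rGamma (1 - \<nu>)\<close> survives, and the reflection formula evaluates
  it.\<close>

lemma bessel_series_wronskian:
  "bessel_series (\<nu> - 1) z * bessel_series (- \<nu>) z - z * bessel_series (1 - \<nu>) z * bessel_series \<nu> z
     = sin (of_real pi * \<nu>) / of_real pi"
proof -
  let ?S = bessel_series
  define W where "W = (\<lambda>z. ?S (\<nu> - 1) z * ?S (- \<nu>) z - z * ?S (1 - \<nu>) z * ?S \<nu> z)"
  have "(W has_field_derivative 0) (at z)" for z
  proof -
    have r: "z * ?S (1 - \<nu> + 1) z = ?S (- \<nu>) z - (1 - \<nu>) * ?S (1 - \<nu>) z"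
      "z * ?S (\<nu> + 1) z = ?S (\<nu> - 1) z - \<nu> * ?S \<nu> z"
      using bessel_series_recurrence[of z "1 - \<nu>"] bessel_series_recurrence[of z \<nu>] by (simp_all add: algebra_simps)
    have "(W has_field_derivative (?S (\<nu> - 1) z * ?S (- \<nu> + 1) z + ?S (\<nu> - 1 + 1) z * ?S (- \<nu>) z
       - ((z * ?S (1 - \<nu>) z) * ?S (\<nu> + 1) z + (z * ?S (1 - \<nu> + 1) z + 1 * ?S (1 - \<nu>) z) * ?S \<nu> z))) (at z)"
      unfolding W_def
      by (rule derivative_eq_intros bessel_series_deriv refl | simp add: algebra_simps)+
    moreover have "?S (\<nu> - 1) z * ?S (- \<nu> + 1) z + ?S (\<nu> - 1 + 1) z * ?S (- \<nu>) z
       - ((z * ?S (1 - \<nu>) z) * ?S (\<nu> + 1) z + (z * ?S (1 - \<nu> + 1) z + 1 * ?S (1 - \<nu>) z) * ?S \<nu> z)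
       = ?S (\<nu> - 1) z * ?S (1 - \<nu>) z + ?S \<nu> z * ?S (- \<nu>) z
       - (?S (1 - \<nu>) z * (z * ?S (\<nu> + 1) z) + (z * ?S (1 - \<nu> + 1) z + ?S (1 - \<nu>) z) * ?S \<nu> z)"
      by (simp add: algebra_simps)
    moreover have "\<dots> = 0" unfolding r by (simp add: algebra_simps)
    ultimately show ?thesis by simp
  qed
  then obtain c where "W z = c" for z
    using has_field_derivative_zero_constant[of UNIV W] by auto
  then have "W z = W 0" by metis
  also have "W 0 = rGamma \<nu> * rGamma (1 - \<nu>)" by (simp add: W_def bessel_series_0)
  also have "\<dots> = sin (of_real pi * \<nu>) / of_real pi" by (rule rGamma_reflection_complex)
  finally show ?thesis by (simp add: W_def)
qed

section \<open>Schlaefli's integral as a function of its second coefficient\<close>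

lemma exp_diff_le:
  fixes a b m :: real
  assumes "a \<le> m" "b \<le> m"
  shows "\<bar>exp a - exp b\<bar> \<le> \<bar>a - b\<bar> * exp m"
proof -
  have *: "exp y - exp x \<le> (y - x) * exp m" if "x \<le> y" "y \<le> m" for x y :: real
  proof -
    have "exp y * (1 + (x - y)) \<le> exp y * exp (x - y)" by (intro mult_left_mono exp_ge_add_one_self) simp
    then have "exp y - exp x \<le> (y - x) * exp y" by (simp add: algebra_simps flip: exp_add)
    also have "\<dots> \<le> (y - x) * exp m" using that by (intro mult_left_mono) auto
    finally show ?thesis .
  qed
  show ?thesis using *[of a b] *[of b a] assms by (cases "a \<le> b") auto
qed

text \<open>Differentiating the kernel in \<open>C\<close> brings down - exp (- x), which lowers the
  order by one. Differentiation under the integral is by dominated convergence, hence along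
  sequences, with \<open>exp_diff_le\<close> bounding the difference quotients.\<close>

lemma schlaefli_deriv:
  assumes A: "A > 0" and C: "C > 0"
  shows "(schlaefli \<nu> A has_vector_derivative - schlaefli (\<nu> - 1) A C) (at C)"
proof -
  let ?k = "\<lambda>C. schlaefli_kernel \<nu> A C" and ?d = "- schlaefli (\<nu> - 1) A C"
  let ?f = "schlaefli \<nu> A"
  note int = schlaefli_integrable[OF A]
  have lim: "((\<lambda>h. (?f (C + h) - ?f C) /\<^sub>R h) \<longlongrightarrow> ?d) (at 0)"
    unfolding tendsto_at_iff_sequentially
  proof (intro allI impI)
    fix X :: "nat \<Rightarrow> real" assume X: "\<forall>i. X i \<in> UNIV - {0}" "X \<longlonglongrightarrow> 0"
    from X(2) C have "eventually (\<lambda>i. \<bar>X i\<bar> < C / 2) sequentially"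
      by (auto simp: tendsto_iff dist_real_def dest: spec[of _ "C / 2"])
    then obtain N where N: "\<And>i. i \<ge> N \<Longrightarrow> \<bar>X i\<bar> < C / 2" by (auto simp: eventually_sequentially)
    \<comment> \<open>Dropping the first \<open>N\<close> terms keeps \<open>C + Y i\<close> above
      \<open>C / 2\<close>, so the kernel of order \<nu> - 1 at \<open>C / 2\<close> dominates every
      difference quotient.\<close>
    define Y where "Y = (\<lambda>i. X (i + N))"
    have Y: "Y i \<noteq> 0" "\<bar>Y i\<bar> < C / 2" "Y \<longlonglongrightarrow> 0" for i
      using X N[of "i + N"] LIMSEQ_ignore_initial_segment[of X 0 N] by (auto simp: Y_def)
    have CY: "C + Y i > 0" for i using Y(2)[of i] C by linarith
    have "(\<lambda>i. LINT x|lborel. (?k (C + Y i) x - ?k C x) /\<^sub>R Y i) \<longlonglongrightarrow> (LINT x|lborel. - schlaefli_kernel (\<nu> - 1) A C x)"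
    proof (rule integral_dominated_convergence[where w = "\<lambda>x. norm (schlaefli_kernel (\<nu> - 1) A (C / 2) x)"])
      show "integrable lborel (\<lambda>x. norm (schlaefli_kernel (\<nu> - 1) A (C / 2) x))"
        using int[of "C / 2"] C by auto
      have k: "?k c x = exp (\<nu> * of_real x - of_real (A * exp x)) * of_real (exp (- (c * exp (- x))))" for c x
        by (simp add: schlaefli_kernel_def algebra_simps flip: exp_add exp_of_real)
      show "AE x in lborel. (\<lambda>i. (?k (C + Y i) x - ?k C x) /\<^sub>R Y i) \<longlonglongrightarrow> - schlaefli_kernel (\<nu> - 1) A C x"
      proof (rule AE_I2)
        fix x :: real
        have "((\<lambda>c. exp (- (c * exp (- x)))) has_real_derivative - exp (- x) * exp (- (C * exp (- x)))) (at C)"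
          by (auto intro!: derivative_eq_intros)
        then have "((\<lambda>h. (exp (- ((C + h) * exp (- x))) - exp (- (C * exp (- x)))) / h) \<longlongrightarrow> - exp (- x) * exp (- (C * exp (- x)))) (at 0)"
          by (rule DERIV_D)
        then have "(\<lambda>i. (exp (- ((C + Y i) * exp (- x))) - exp (- (C * exp (- x)))) / Y i) \<longlonglongrightarrow> - exp (- x) * exp (- (C * exp (- x)))"
          using Y unfolding tendsto_at_iff_sequentially o_def by auto
        then have "(\<lambda>i. exp (\<nu> * of_real x - of_real (A * exp x)) * of_real ((exp (- ((C + Y i) * exp (- x))) - exp (- (C * exp (- x)))) / Y i)) \<longlonglongrightarrow>
            exp (\<nu> * of_real x - of_real (A * exp x)) * of_real (- exp (- x) * exp (- (C * exp (- x))))"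
          by (intro tendsto_intros)
        also have "exp (\<nu> * of_real x - of_real (A * exp x)) * of_real (- exp (- x) * exp (- (C * exp (- x)))) = - schlaefli_kernel (\<nu> - 1) A C x"
          unfolding schlaefli_kernel_diff_1 k by simp
        also have "(\<lambda>i. exp (\<nu> * of_real x - of_real (A * exp x)) * of_real ((exp (- ((C + Y i) * exp (- x))) - exp (- (C * exp (- x)))) / Y i))
            = (\<lambda>i. (?k (C + Y i) x - ?k C x) /\<^sub>R Y i)"
          unfolding k using Y(1) by (auto simp: fun_eq_iff scaleR_conv_of_real field_simps)
        finally show "(\<lambda>i. (?k (C + Y i) x - ?k C x) /\<^sub>R Y i) \<longlonglongrightarrow> - schlaefli_kernel (\<nu> - 1) A C x" .
      qed
      show "AE x in lborel. norm ((?k (C + Y i) x - ?k C x) /\<^sub>R Y i) \<le> norm (schlaefli_kernel (\<nu> - 1) A (C / 2) x)" for i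
      proof (rule AE_I2)
        fix x :: real
        let ?y = "exp (- x)"
        have "\<bar>exp (- ((C + Y i) * ?y)) - exp (- (C * ?y))\<bar> \<le> \<bar>- ((C + Y i) * ?y) - - (C * ?y)\<bar> * exp (- (C / 2 * ?y))"
        proof (rule exp_diff_le)
          have "C / 2 * ?y \<le> (C + Y i) * ?y" "C / 2 * ?y \<le> C * ?y"
            using Y(2)[of i] C by (intro mult_right_mono; linarith | simp)+
          then show "- ((C + Y i) * ?y) \<le> - (C / 2 * ?y)" "- (C * ?y) \<le> - (C / 2 * ?y)" by auto
        qed
        also have "\<dots> = \<bar>Y i\<bar> * (?y * exp (- (C / 2 * ?y)))" by (simp add: algebra_simps abs_mult)
        finally have "norm (?k (C + Y i) x - ?k C x) \<le> exp (Re \<nu> * x - A * exp x) * (\<bar>Y i\<bar> * (?y * exp (- (C / 2 * ?y))))"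
          unfolding k right_diff_distrib[symmetric] of_real_diff[symmetric] norm_mult norm_of_real
          by (intro mult_mono) auto
        also have "\<dots> = \<bar>Y i\<bar> * norm (schlaefli_kernel (\<nu> - 1) A (C / 2) x)"
          unfolding schlaefli_kernel_diff_1 k by (simp add: norm_mult)
        finally show "norm ((?k (C + Y i) x - ?k C x) /\<^sub>R Y i) \<le> norm (schlaefli_kernel (\<nu> - 1) A (C / 2) x)"
          unfolding norm_scaleR using Y(1)[of i] by (simp only: abs_inverse real_norm_def) (simp add: field_simps)
      qed
    qed auto
    moreover have "(LINT x|lborel. (?k (C + Y i) x - ?k C x) /\<^sub>R Y i) = (?f (C + Y i) - ?f C) /\<^sub>R Y i" for i
      using int[OF C] int[OF CY[of i]] by (simp add: schlaefli_def)
    moreover have "(LINT x|lborel. - schlaefli_kernel (\<nu> - 1) A C x) = ?d"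
      by (simp add: schlaefli_def)
    ultimately have "(\<lambda>i. (?f (C + Y i) - ?f C) /\<^sub>R Y i) \<longlonglongrightarrow> ?d" by (simp only:)
    then show "((\<lambda>h. (?f (C + h) - ?f C) /\<^sub>R h) \<circ> X) \<longlonglongrightarrow> ?d"
      unfolding Y_def o_def by (rule LIMSEQ_offset)
  qed
  show ?thesis unfolding has_vector_derivative_def has_derivative_at
  proof
    have lim0: "((\<lambda>h. norm ((?f (C + h) - ?f C) /\<^sub>R h - ?d)) \<longlongrightarrow> 0) (at 0)"
      using lim by (intro tendsto_norm_zero LIM_zero)
    have eq: "norm (?f (C + h) - ?f C - h *\<^sub>R ?d) / norm h = norm ((?f (C + h) - ?f C) /\<^sub>R h - ?d)" if "h \<noteq> 0" for h
    proof -
      have "?f (C + h) - ?f C - h *\<^sub>R ?d = h *\<^sub>R ((?f (C + h) - ?f C) /\<^sub>R h - ?d)"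
        using that by (simp add: algebra_simps)
      then show ?thesis using that by simp
    qed
    show "((\<lambda>h. norm (?f (C + h) - ?f C - h *\<^sub>R ?d) / norm h) \<longlongrightarrow> 0) (at 0)"
      by (rule Lim_transform_eventually[OF lim0], unfold eventually_at_filter)
         (intro always_eventually allI impI eq[symmetric])
  qed (rule bounded_linear_scaleR_left)
qed

text \<open>In the limit the kernel becomes a Gamma integrand, which also dominates it when Re \<nu>
  > 0. For the second limit the factor \<open>X n\<close> buys one more unit of order, through
  \<open>X n * exp (- (X n * exp (- x))) \<le> exp x\<close>. The two parts treat the two terms of
  the identity \<open>schlaefli_wronskian\<close> for Re \<nu> < 1.\<close>

lemma schlaefli_at_0:
  assumes A: "A > 0" and X: "\<And>n. X n > 0" "X \<longlonglongrightarrow> 0"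
  shows "Re \<nu> > 0 \<Longrightarrow> (\<lambda>n. schlaefli \<nu> A (X n)) \<longlonglongrightarrow> Gamma \<nu> / of_real A powr \<nu>"
    and "Re \<nu> > -1 \<Longrightarrow> (\<lambda>n. of_real (X n) * schlaefli \<nu> A (X n)) \<longlonglongrightarrow> 0"
proof -
  have k: "schlaefli_kernel \<nu> A c x = exp (\<nu> * of_real x - of_real (A * exp x)) * of_real (exp (- (c * exp (- x))))" for c x \<nu>
    by (simp add: schlaefli_kernel_def algebra_simps flip: exp_add exp_of_real)
  have lim: "(\<lambda>n. exp (- (X n * exp (- x)))) \<longlonglongrightarrow> 1" for x :: real
    using X(2) by (auto intro!: tendsto_eq_intros)
  {
    assume \<nu>: "Re \<nu> > 0"
    have "(\<lambda>n. schlaefli \<nu> A (X n)) \<longlonglongrightarrow> (LINT x|lborel. exp (\<nu> * of_real x - of_real (A * exp x)))"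
      unfolding schlaefli_def
    proof (rule integral_dominated_convergence[where w = "\<lambda>x. norm (exp (\<nu> * of_real x - of_real (A * exp x)))"])
      show "integrable lborel (\<lambda>x. norm (exp (\<nu> * of_real x - of_real (A * exp x))))"
        using exp_shift_integral(1)[OF \<nu> A] by (rule integrable_norm)
      show "(\<lambda>x. exp (\<nu> * of_real x - of_real (A * exp x))) \<in> borel_measurable lborel"
        using exp_shift_integral(1)[OF \<nu> A] by (rule borel_measurable_integrable)
      show "AE x in lborel. (\<lambda>n. schlaefli_kernel \<nu> A (X n) x) \<longlonglongrightarrow> exp (\<nu> * of_real x - of_real (A * exp x))"
      proof (rule AE_I2)
        fix x :: real
        show "(\<lambda>n. schlaefli_kernel \<nu> A (X n) x) \<longlonglongrightarrow> exp (\<nu> * of_real x - of_real (A * exp x))"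
        proof -
          have "(\<lambda>n. exp (\<nu> * of_real x - of_real (A * exp x)) * of_real (exp (- (X n * exp (- x)))))
              \<longlonglongrightarrow> exp (\<nu> * of_real x - of_real (A * exp x)) * of_real 1"
            by (intro tendsto_mult tendsto_const tendsto_of_real lim)
          then show ?thesis by (simp only: k of_real_1 mult_1_right)
        qed
      qed
      show "AE x in lborel. norm (schlaefli_kernel \<nu> A (X n) x) \<le> norm (exp (\<nu> * of_real x - of_real (A * exp x)))" for n
        unfolding k norm_mult using X(1)[of n] by (intro AE_I2 mult_left_le) auto
    qed auto
    then show "(\<lambda>n. schlaefli \<nu> A (X n)) \<longlonglongrightarrow> Gamma \<nu> / of_real A powr \<nu>"
      by (simp only: exp_shift_integral(2)[OF \<nu> A])
  }
  {
    assume "Re \<nu> > -1"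
    then have \<nu>: "Re (\<nu> + 1) > 0" by simp
    have "(\<lambda>n. LINT x|lborel. of_real (X n) * schlaefli_kernel \<nu> A (X n) x) \<longlonglongrightarrow> (LINT x|(lborel :: real measure). 0)"
    proof (rule integral_dominated_convergence[where w = "\<lambda>x. norm (exp ((\<nu> + 1) * of_real x - of_real (A * exp x)))"])
      show "integrable lborel (\<lambda>x. norm (exp ((\<nu> + 1) * of_real x - of_real (A * exp x))))"
        using exp_shift_integral(1)[OF \<nu> A] by (rule integrable_norm)
      show "AE x in lborel. (\<lambda>n. of_real (X n) * schlaefli_kernel \<nu> A (X n) x) \<longlonglongrightarrow> 0"
      proof (rule AE_I2)
        fix x :: real
        show "(\<lambda>n. of_real (X n) * schlaefli_kernel \<nu> A (X n) x) \<longlonglongrightarrow> 0"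
        proof -
          have "(\<lambda>n. of_real (X n) * (exp (\<nu> * of_real x - of_real (A * exp x)) * of_real (exp (- (X n * exp (- x))))))
              \<longlonglongrightarrow> of_real 0 * (exp (\<nu> * of_real x - of_real (A * exp x)) * of_real 1)"
            by (intro tendsto_mult tendsto_const tendsto_of_real lim X)
          then show ?thesis by (simp only: k of_real_0 mult_zero_left)
        qed
      qed
      show "AE x in lborel. norm (of_real (X n) * schlaefli_kernel \<nu> A (X n) x) \<le> norm (exp ((\<nu> + 1) * of_real x - of_real (A * exp x)))" for n
      proof (rule AE_I2)
        fix x :: real
        have "X n * exp (- (X n * exp (- x))) \<le> exp x"
          using exp_neg_exp_bound[OF X(1)[of n], of x 1] X(1)[of n] by (simp add: field_simps)
        then have "exp (Re \<nu> * x - A * exp x) * (X n * exp (- (X n * exp (- x)))) \<le> exp (Re \<nu> * x - A * exp x) * exp x"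
          by (rule mult_left_mono) simp
        then show "norm (of_real (X n) * schlaefli_kernel \<nu> A (X n) x) \<le> norm (exp ((\<nu> + 1) * of_real x - of_real (A * exp x)))"
          unfolding k norm_mult using X(1)[of n] by (simp add: algebra_simps flip: exp_add)
      qed
    qed auto
    then show "(\<lambda>n. of_real (X n) * schlaefli \<nu> A (X n)) \<longlonglongrightarrow> 0"
      by (simp add: schlaefli_def)
  }
qed

text \<open>Scaling and reflection combined: K is even in the order, and the power of
  \<open>C\<close> reflects that \<open>schlaefli \<nu> 1 C\<close> is K times 2 C to the power
  \<nu> / 2.\<close>

lemma schlaefli_inversion:
  assumes C: "C > 0"
  shows "schlaefli (- \<nu>) 1 C = exp (- \<nu> * of_real (ln C)) * schlaefli \<nu> 1 C"
  using schlaefli_scale[OF C, of 1 \<nu>] by (simp add: schlaefli_uminus)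

text \<open>The left-hand side is constant in \<open>C\<close>; for \<open>Re \<nu> < 1\<close> it tends to 1 as \<open>C\<close> tends to 0, and by the
  three-term recurrences it is periodic in \<open>\<nu>\<close> with period 1.\<close>
lemma schlaefli_wronskian:
  assumes C: "C > 0"
  shows "exp ((1 - \<nu>) * of_real (ln C)) * schlaefli \<nu> 1 C * bessel_series (1 - \<nu>) (of_real C)
       + schlaefli (1 - \<nu>) 1 C * bessel_series (- \<nu>) (of_real C) = 1"
proof -
  let ?f = "\<lambda>\<nu> C. schlaefli \<nu> 1 C" and ?S = "\<lambda>\<nu> C. bessel_series \<nu> (complex_of_real C)"
  let ?e = "\<lambda>\<mu> C. exp (\<mu> * complex_of_real (ln C))"
  define W where "W = (\<lambda>\<nu> C. ?e (1 - \<nu>) C * ?f \<nu> C * ?S (1 - \<nu>) C + ?f (1 - \<nu>) C * ?S (- \<nu>) C)"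
  have eadd: "?e (\<mu> + \<mu>') C = ?e \<mu> C * ?e \<mu>' C" for \<mu> \<mu>' C
    by (simp add: distrib_right exp_add)
  have e1: "?e 1 C = of_real C" if "C > 0" for C using that by (simp add: exp_of_real)
  have S: "of_real C * ?S (\<nu> + 1) C = ?S (\<nu> - 1) C - \<nu> * ?S \<nu> C" for \<nu> C
    using bessel_series_recurrence[of "of_real C" \<nu>] by (simp add: algebra_simps)
  have W1: "W \<nu> C = 1" if \<nu>: "Re \<nu> < 1" and C: "C > 0" for \<nu> C
  proof -
    have "(W \<nu> has_vector_derivative 0) (at C within {0<..})" if C: "C \<in> {0<..}" for C
    proof (rule has_vector_derivative_at_within)
      have C: "C > 0" using C by simp
      have "((\<lambda>C. (1 - \<nu>) * of_real (ln C)) has_vector_derivative (1 - \<nu>) * of_real (1 / C)) (at C)"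
        using C by (intro has_vector_derivative_mult_right has_vector_derivative_of_real) (auto intro!: derivative_eq_intros)
      from field_vector_diff_chain_at[OF this, of exp "?e (1 - \<nu>) C"]
      have de: "(?e (1 - \<nu>) has_vector_derivative (1 - \<nu>) * of_real (1 / C) * ?e (1 - \<nu>) C) (at C)"
        by (auto simp: o_def intro!: DERIV_exp)
      have dS: "(?S \<mu> has_vector_derivative ?S (\<mu> + 1) C) (at C)" for \<mu>
        using field_vector_diff_chain_at[OF has_vector_derivative_of_real[OF DERIV_ident] bessel_series_deriv[of \<mu> "of_real C"]]
        by (simp add: o_def)
      have df: "(?f \<mu> has_vector_derivative - ?f (\<mu> - 1) C) (at C)" for \<mu>
        using C by (intro schlaefli_deriv) auto
      note has_vector_derivative_add[OF has_vector_derivative_mult[OF has_vector_derivative_mult[OF de df] dS]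
          has_vector_derivative_mult[OF df dS], of \<nu> "1 - \<nu>" "1 - \<nu>" "- \<nu>"]
      then have d: "(W \<nu> has_vector_derivative
          ?e (1 - \<nu>) C * ?f \<nu> C * ?S (1 - \<nu> + 1) C + (?e (1 - \<nu>) C * - ?f (\<nu> - 1) C + (1 - \<nu>) * of_real (1 / C) * ?e (1 - \<nu>) C * ?f \<nu> C) * ?S (1 - \<nu>) C
          + (?f (1 - \<nu>) C * ?S (- \<nu> + 1) C + - ?f (1 - \<nu> - 1) C * ?S (- \<nu>) C)) (at C)"
        unfolding W_def .
      \<comment> \<open>With \<open>q\<close> equal to C to the power - \<nu>, inversion expresses
        orders 1 - \<nu> and - \<nu> through \<nu> - 1 and \<nu>, so only two unknown integrals
        remain and the derivative cancels term by term.\<close>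
      define q where "q = ?e (- \<nu>) C"
      have e: "?e (1 - \<nu>) C = of_real C * q" unfolding q_def using eadd[of 1 "- \<nu>" C] e1[OF C] by simp
      have f1: "?f (1 - \<nu>) C = of_real C * q * ?f (\<nu> - 1) C"
        using schlaefli_inversion[OF C, of "\<nu> - 1"] e by simp
      have f2: "?f (- \<nu>) C = q * ?f \<nu> C"
        using schlaefli_inversion[OF C, of \<nu>] by (simp add: q_def)
      have s: "of_real C * ?S (1 - \<nu> + 1) C = ?S (- \<nu>) C - (1 - \<nu>) * ?S (1 - \<nu>) C"
        using S[of C "1 - \<nu>"] by simp
      have "?e (1 - \<nu>) C * ?f \<nu> C * ?S (1 - \<nu> + 1) C + (?e (1 - \<nu>) C * - ?f (\<nu> - 1) C + (1 - \<nu>) * of_real (1 / C) * ?e (1 - \<nu>) C * ?f \<nu> C) * ?S (1 - \<nu>) C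
          + (?f (1 - \<nu>) C * ?S (- \<nu> + 1) C + - ?f (1 - \<nu> - 1) C * ?S (- \<nu>) C)
        = q * ?f \<nu> C * (of_real C * ?S (1 - \<nu> + 1) C) + (of_real C * q * - ?f (\<nu> - 1) C + (1 - \<nu>) * q * ?f \<nu> C) * ?S (1 - \<nu>) C
          + (of_real C * q * ?f (\<nu> - 1) C * ?S (1 - \<nu>) C - q * ?f \<nu> C * ?S (- \<nu>) C)"
        unfolding e f1 using C by (simp add: f2 field_simps)
      also have "\<dots> = 0" unfolding s by (simp add: algebra_simps)
      finally show "(W \<nu> has_vector_derivative 0) (at C)" using d by simp
    qed
    then obtain c where c: "\<And>C. C > 0 \<Longrightarrow> W \<nu> C = c"
      using has_vector_derivative_zero_constant[of "{0<..}" "W \<nu>"] by auto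
    define X where "X = (\<lambda>n. inverse (real (Suc n)))"
    have X: "X n > 0" "X \<longlonglongrightarrow> 0" for n
      unfolding X_def using LIMSEQ_inverse_real_of_nat by auto
    have lS: "(\<lambda>n. ?S \<mu> (X n)) \<longlonglongrightarrow> rGamma (\<mu> + 1)" for \<mu>
    proof -
      have "isCont (bessel_series \<mu>) 0" using bessel_series_deriv by (rule DERIV_isCont)
      then have "(\<lambda>n. ?S \<mu> (X n)) \<longlonglongrightarrow> bessel_series \<mu> 0"
        using X(2) by (intro isCont_tendsto_compose[of _ "bessel_series \<mu>"]) (auto intro!: tendsto_eq_intros)
      then show ?thesis by (simp add: bessel_series_0)
    qed
    \<comment> \<open>Inversion trades the power of \<open>X n\<close> for a plain factor
      \<open>X n\<close> in front of order - \<nu>, whose real part exceeds -1; the other order 1 -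
      \<nu> has positive real part. Both limits of \<open>schlaefli_at_0\<close> now apply.\<close>
    have "W \<nu> (X n) = of_real (X n) * ?f (- \<nu>) (X n) * ?S (1 - \<nu>) (X n) + ?f (1 - \<nu>) (X n) * ?S (- \<nu>) (X n)" for n
      unfolding W_def using eadd[of 1 "- \<nu>" "X n"] e1[OF X(1)[of n]] schlaefli_inversion[OF X(1)[of n], of \<nu>] by simp
    moreover have "(\<lambda>n. of_real (X n) * ?f (- \<nu>) (X n) * ?S (1 - \<nu>) (X n) + ?f (1 - \<nu>) (X n) * ?S (- \<nu>) (X n))
        \<longlonglongrightarrow> 0 * rGamma (1 - \<nu> + 1) + Gamma (1 - \<nu>) / of_real 1 powr (1 - \<nu>) * rGamma (- \<nu> + 1)"
      by (intro tendsto_add tendsto_mult lS schlaefli_at_0 X) (use \<nu> in auto)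
    moreover have "0 * rGamma (1 - \<nu> + 1) + Gamma (1 - \<nu>) / of_real 1 powr (1 - \<nu>) * rGamma (- \<nu> + 1) = 1"
    proof -
      have "1 - \<nu> \<notin> \<int>\<^sub>\<le>\<^sub>0" using \<nu> by (auto elim!: nonpos_Ints_cases simp: complex_eq_iff)
      then show ?thesis by (simp add: rGamma_inverse_Gamma Gamma_eq_zero_iff)
    qed
    ultimately have "(\<lambda>n. W \<nu> (X n)) \<longlonglongrightarrow> 1" by simp
    then have "(\<lambda>n::nat. c) \<longlonglongrightarrow> 1" by (simp add: c[OF X(1)])
    then show ?thesis using c[OF C] by (simp add: LIMSEQ_const_iff)
  qed
  have W2: "W (\<nu> + 1) C = W \<nu> C" for \<nu>
  proof -
    define q where "q = ?e (- \<nu>) C"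
    have e: "?e (1 - \<nu>) C = of_real C * q" unfolding q_def using eadd[of 1 "- \<nu>" C] e1[OF C] by simp
    have f1: "?f (1 - \<nu>) C = of_real C * q * ?f (\<nu> - 1) C"
      using schlaefli_inversion[OF C, of "\<nu> - 1"] e by simp
    have f2: "?f (- \<nu>) C = q * ?f \<nu> C"
      using schlaefli_inversion[OF C, of \<nu>] by (simp add: q_def)
    have f3: "?f (\<nu> + 1) C = \<nu> * ?f \<nu> C + of_real C * ?f (\<nu> - 1) C"
      using schlaefli_recurrence[of 1 C \<nu>] C by (simp add: algebra_simps)
    have p: "?e (1 - (\<nu> + 1)) C = q" "?f (1 - (\<nu> + 1)) C = q * ?f \<nu> C" "?S (1 - (\<nu> + 1)) C = ?S (- \<nu>) C"
      "?S (- (\<nu> + 1)) C = of_real C * ?S (1 - \<nu>) C - \<nu> * ?S (- \<nu>) C"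
    proof -
      have m: "1 - (\<nu> + 1) = - \<nu>" "- (\<nu> + 1) = - \<nu> - 1" by simp_all
      show "?e (1 - (\<nu> + 1)) C = q" "?f (1 - (\<nu> + 1)) C = q * ?f \<nu> C" "?S (1 - (\<nu> + 1)) C = ?S (- \<nu>) C"
        "?S (- (\<nu> + 1)) C = of_real C * ?S (1 - \<nu>) C - \<nu> * ?S (- \<nu>) C"
        unfolding m using S[of C "- \<nu>"] f2 by (simp_all add: q_def)
    qed
    \<comment> \<open>The two recurrences contribute the same multiple of \<nu> with opposite signs;
      what is left is \<open>W \<nu> C\<close>.\<close>
    show ?thesis unfolding W_def p f3 e f1
      by (simp add: algebra_simps)
  qed
  have W3: "W \<nu> C = 1" if "Re \<nu> < 1 + real N" for N \<nu>
    using that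
  proof (induction N arbitrary: \<nu>)
    case 0 then show ?case using W1 C by simp
  next
    case (Suc N)
    then have "W (\<nu> - 1) C = 1" by (intro Suc) auto
    then show ?case using W2[of "\<nu> - 1"] by simp
  qed
  obtain N where "Re \<nu> < real N" using reals_Archimedean2 by blast
  then have "W \<nu> C = 1" by (intro W3[of _ N]) linarith
  then show ?thesis by (simp add: W_def)
qed

text \<open>The identity \<open>schlaefli_wronskian\<close> at \<nu> and at 1 - \<nu> is a linear
  system for the integrals of orders \<nu> and 1 - \<nu>. Eliminating the latter leaves the former
  times the determinant, which \<open>bessel_series_wronskian\<close> evaluates.\<close>

lemma schlaefli_eq_series:
  assumes C: "C > 0"
  shows "schlaefli \<nu> 1 C * (sin (of_real pi * \<nu>) / of_real pi)
     = bessel_series (- \<nu>) (of_real C) - exp (\<nu> * of_real (ln C)) * bessel_series \<nu> (of_real C)"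
proof -
  let ?f = "\<lambda>\<nu>. schlaefli \<nu> 1 C" and ?S = "\<lambda>\<nu>. bessel_series \<nu> (complex_of_real C)"
  let ?e = "\<lambda>\<mu>. exp (\<mu> * complex_of_real (ln C))"
  have A: "?e (1 - \<nu>) * ?f \<nu> * ?S (1 - \<nu>) + ?f (1 - \<nu>) * ?S (- \<nu>) = 1"
    using schlaefli_wronskian[OF C, of \<nu>] by simp
  have B: "?e \<nu> * ?f (1 - \<nu>) * ?S \<nu> + ?f \<nu> * ?S (\<nu> - 1) = 1"
    using schlaefli_wronskian[OF C, of "1 - \<nu>"] by simp
  have e: "?e \<nu> * ?e (1 - \<nu>) = of_real C"
    using C by (simp add: algebra_simps exp_of_real flip: exp_add)
  have "?f \<nu> * (sin (of_real pi * \<nu>) / of_real pi) = ?f \<nu> * ?S (\<nu> - 1) * ?S (- \<nu>) - of_real C * ?f \<nu> * ?S (1 - \<nu>) * ?S \<nu>"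
    unfolding bessel_series_wronskian[symmetric, of \<nu> "of_real C"] by (simp add: algebra_simps)
  also have "\<dots> = ?S (- \<nu>) - ?e \<nu> * ?S \<nu>"
  proof -
    have "f * s1 * s2 - c * f * s3 * s4 = s2 - E * s4"
      if "E' * f * s3 + g * s2 = 1" "E * g * s4 + f * s1 = 1" "E * E' = c"
      for f g s1 s2 s3 s4 c E E' :: complex
      using that by algebra
    from this[OF A B e] show ?thesis .
  qed
  finally show ?thesis .
qed

lemma schlaefli_tendsto:
  assumes A: "A > 0" and C: "C > 0"
  shows "((\<lambda>\<mu>. schlaefli \<mu> A C) \<longlongrightarrow> schlaefli \<nu> A C) (at \<nu>)"
  unfolding tendsto_at_iff_sequentially
proof (intro allI impI)
  fix X assume X: "X \<longlonglongrightarrow> \<nu>"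
  then have "eventually (\<lambda>n. dist (X n) \<nu> < 1) sequentially" by (rule tendstoD) simp
  then obtain N where N: "\<And>n. n \<ge> N \<Longrightarrow> dist (X n) \<nu> < 1" by (auto simp: eventually_sequentially)
  \<comment> \<open>For orders within distance 1 of \<nu>, one summand bounds the kernel for x \<ge>
    0 and the other for x < 0.\<close>
  let ?w = "\<lambda>x. norm (schlaefli_kernel (\<nu> - 1) A C x) + norm (schlaefli_kernel (\<nu> + 1) A C x)"
  have "(\<lambda>n. schlaefli (X (n + N)) A C) \<longlonglongrightarrow> schlaefli \<nu> A C"
    unfolding schlaefli_def
  proof (rule integral_dominated_convergence[where w = ?w])
    show "integrable lborel ?w" using schlaefli_integrable[OF A C] by auto
    show "AE x in lborel. (\<lambda>n. schlaefli_kernel (X (n + N)) A C x) \<longlonglongrightarrow> schlaefli_kernel \<nu> A C x"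
      unfolding schlaefli_kernel_def
      by (intro AE_I2 tendsto_intros LIMSEQ_ignore_initial_segment X)
    show "AE x in lborel. norm (schlaefli_kernel (X (n + N)) A C x) \<le> ?w x" for n
    proof (rule AE_I2)
      fix x :: real
      have nk: "norm (schlaefli_kernel \<mu> A C x) = exp (Re \<mu> * x) * exp (- (A * exp x + C * exp (- x)))" for \<mu>
        by (simp add: norm_schlaefli_kernel flip: exp_add)
      have "\<bar>Re (X (n + N)) - Re \<nu>\<bar> \<le> 1"
        using N[of "n + N"] abs_Re_le_cmod[of "X (n + N) - \<nu>"] by (simp add: dist_norm)
      then have r: "Re (X (n + N)) \<le> Re \<nu> + 1" "Re \<nu> - 1 \<le> Re (X (n + N))" by linarith+
      have "exp (Re (X (n + N)) * x) \<le> exp ((Re \<nu> - 1) * x) + exp ((Re \<nu> + 1) * x)"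
      proof (cases "x \<ge> 0")
        case True
        then have "exp (Re (X (n + N)) * x) \<le> exp ((Re \<nu> + 1) * x)" using r by (simp add: mult_right_mono)
        then show ?thesis by (smt (verit) exp_gt_zero)
      next
        case False
        then have "exp (Re (X (n + N)) * x) \<le> exp ((Re \<nu> - 1) * x)" using r by (simp add: mult_right_mono_neg)
        then show ?thesis by (smt (verit) exp_gt_zero)
      qed
      then have "exp (Re (X (n + N)) * x) * exp (- (A * exp x + C * exp (- x)))
          \<le> (exp ((Re \<nu> - 1) * x) + exp ((Re \<nu> + 1) * x)) * exp (- (A * exp x + C * exp (- x)))"
        by (rule mult_right_mono) simp
      then show "norm (schlaefli_kernel (X (n + N)) A C x) \<le> ?w x"
        unfolding nk by (simp only: minus_complex.sel plus_complex.sel one_complex.sel distrib_right)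
    qed
  qed auto
  then show "((\<lambda>\<mu>. schlaefli \<mu> A C) \<circ> X) \<longlonglongrightarrow> schlaefli \<nu> A C"
    unfolding o_def by (rule LIMSEQ_offset)
qed

lemma bessel_I_eq_series:
  assumes C: "C > 0"
  shows "bessel_I \<nu> (of_real (2 * sqrt C)) = exp (\<nu> / 2 * of_real (ln C)) * bessel_series \<nu> (of_real C)"
proof -
  have "(of_real (2 * sqrt C) / 2) powr (\<nu> + 2 * of_nat k) = exp (\<nu> / 2 * of_real (ln C)) * of_real C ^ k" for k
  proof -
    have "(of_real (2 * sqrt C) / 2 :: complex) = of_real (sqrt C)" by simp
    moreover have "Ln (of_real (sqrt C)) = of_real (ln C / 2)"
      using C by (subst Ln_of_real) (simp_all add: ln_sqrt)
    moreover have "of_real (sqrt C) \<noteq> (0 :: complex)" using C by simp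
    ultimately have "(of_real (2 * sqrt C) / 2) powr (\<nu> + 2 * of_nat k) = exp ((\<nu> + 2 * of_nat k) * of_real (ln C / 2))"
      by (simp only: powr_def if_False)
    also have "\<dots> = exp (\<nu> / 2 * of_real (ln C)) * exp (of_nat k * of_real (ln C))"
      by (simp add: exp_add [symmetric] algebra_simps add_divide_distrib)
    also have "exp (of_nat k * of_real (ln C)) = (of_real C :: complex) ^ k"
      using C by (simp add: exp_of_nat_mult exp_of_real)
    finally show ?thesis .
  qed
  then have "bessel_I \<nu> (of_real (2 * sqrt C))
      = (\<Sum>k. exp (\<nu> / 2 * of_real (ln C)) * (rGamma (of_nat k + 1) * rGamma (of_nat k + \<nu> + 1) * of_real C ^ k))"
    unfolding bessel_I_def by (simp only: mult_ac)
  also have "\<dots> = exp (\<nu> / 2 * of_real (ln C)) * bessel_series \<nu> (of_real C)"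
    unfolding bessel_series_def by (rule suminf_mult[OF bessel_series_summable])
  finally show ?thesis .
qed

lemma schlaefli_eq_bessel_K_quotient:
  assumes C: "C > 0" and \<nu>: "\<nu> \<notin> \<int>"
  shows "schlaefli \<nu> 1 C = 2 * exp (\<nu> / 2 * of_real (ln C)) * bessel_K_quotient \<nu> (of_real (2 * sqrt C))"
proof -
  let ?e = "\<lambda>\<mu>. exp (\<mu> * complex_of_real (ln C))" and ?S = "\<lambda>\<nu>. bessel_series \<nu> (complex_of_real C)"
  let ?s = "sin (of_real pi * \<nu>)"
  have s: "?s \<noteq> 0"
  proof
    assume "?s = 0"
    then obtain i :: int where "of_real pi * \<nu> = of_real (of_int i * pi)"
      by (auto simp: Complex_Transcendental.sin_eq_0)
    then have "\<nu> = of_int i" by simp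
    with \<nu> show False by simp
  qed
  have e: "?e (\<nu> / 2) * ?e (- \<nu> / 2) = 1" "?e (\<nu> / 2) * ?e (\<nu> / 2) = ?e \<nu>"
    by (simp_all add: distrib_right [symmetric] flip: exp_add)
  have "2 * ?e (\<nu> / 2) * bessel_K_quotient \<nu> (of_real (2 * sqrt C))
      = of_real pi / ?s * (?e (\<nu> / 2) * ?e (- \<nu> / 2) * ?S (- \<nu>) - ?e (\<nu> / 2) * ?e (\<nu> / 2) * ?S \<nu>)"
    unfolding bessel_K_quotient_def bessel_I_eq_series[OF C] using s by (simp add: field_simps)
  also have "\<dots> = of_real pi / ?s * (schlaefli \<nu> 1 C * (?s / of_real pi))"
    unfolding e schlaefli_eq_series[OF C] by simp
  also have "\<dots> = schlaefli \<nu> 1 C" using s by simp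
  finally show ?thesis by simp
qed

text \<open>For integral \<open>\<nu>\<close> both sides are limits of their values at nearby non-integral orders.\<close>
lemma schlaefli_eq_bessel_K:
  assumes C: "C > 0"
  shows "schlaefli \<nu> 1 C = 2 * exp (\<nu> / 2 * of_real (ln C)) * bessel_K \<nu> (of_real (2 * sqrt C))"
proof (cases "\<nu> \<in> \<int>")
  case False
  then show ?thesis using schlaefli_eq_bessel_K_quotient[OF C] by (simp add: bessel_K_def)
next
  case True
  let ?e = "\<lambda>\<mu>. exp (\<mu> / 2 * complex_of_real (ln C))"
  \<comment> \<open>Distinct integers are at distance at least 1, so the punctured unit disc around
    \<nu> contains none.\<close>
  have "eventually (\<lambda>\<mu>. \<mu> \<notin> \<int>) (at \<nu>)"
    unfolding eventually_at
  proof (intro exI[of _ 1] conjI ballI impI)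
    fix \<mu> assume \<mu>: "\<mu> \<noteq> \<nu> \<and> dist \<mu> \<nu> < 1"
    show "\<mu> \<notin> \<int>"
    proof
      assume "\<mu> \<in> \<int>"
      with True have "\<mu> - \<nu> \<in> \<int>" by simp
      then obtain i where i: "\<mu> - \<nu> = of_int i" by (elim Ints_cases)
      then have "\<bar>i\<bar> < 1" using \<mu> by (simp add: dist_norm flip: of_int_abs)
      then show False using i \<mu> by simp
    qed
  qed simp
  then have ev: "eventually (\<lambda>\<mu>. schlaefli \<mu> 1 C / (2 * ?e \<mu>) = bessel_K_quotient \<mu> (of_real (2 * sqrt C))) (at \<nu>)"
    by eventually_elim (simp add: schlaefli_eq_bessel_K_quotient[OF C])
  have "((\<lambda>\<mu>. schlaefli \<mu> 1 C / (2 * ?e \<mu>)) \<longlongrightarrow> schlaefli \<nu> 1 C / (2 * ?e \<nu>)) (at \<nu>)"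
    by (intro tendsto_intros schlaefli_tendsto C) auto
  then have "((\<lambda>\<mu>. bessel_K_quotient \<mu> (of_real (2 * sqrt C))) \<longlongrightarrow> schlaefli \<nu> 1 C / (2 * ?e \<nu>)) (at \<nu>)"
    by (rule Lim_transform_eventually[OF _ ev])
  then have "bessel_K \<nu> (of_real (2 * sqrt C)) = schlaefli \<nu> 1 C / (2 * ?e \<nu>)"
    using True by (simp add: bessel_K_def tendsto_Lim)
  then show ?thesis by simp
qed

corollary schlaefli_bessel_K:
  assumes A: "A > 0" and C: "C > 0"
  shows "schlaefli \<nu> A C = 2 * of_real (sqrt (C / A)) powr \<nu> * bessel_K \<nu> (of_real (2 * sqrt (A * C)))"
proof -
  have "of_real (sqrt (C / A)) powr \<nu> = exp (\<nu> * of_real (ln (C / A) / 2))"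
    using A C by (simp add: powr_def Ln_of_real ln_sqrt)
  also have "\<dots> = exp (- \<nu> * of_real (ln A)) * exp (\<nu> / 2 * of_real (ln (A * C)))"
    using A C by (simp add: ln_div ln_mult algebra_simps diff_divide_distrib add_divide_distrib flip: exp_add)
  finally show ?thesis
    unfolding schlaefli_scale[OF A C] schlaefli_eq_bessel_K[OF mult_pos_pos[OF A C]] by (simp add: mult_ac)
qed

subsection \<open>The partial Fourier transform\<close>

text \<open>The inverse power is a superposition of Gaussians exp (- t |y|^2). Their transforms
  contribute t to the power - d / 2, lowering the order from \<open>a\<close> to
  \<open>a - d / 2\<close>, and exp (- |w|^2 / (4 t)), which supplies the second coefficient. The
  bound on \<open>Re a\<close> makes the interchange absolutely convergent, also at w = 0.\<close>

lemma fourier_inverse_power: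
  fixes w :: "'a::euclidean_space" and a :: complex
  assumes Y: "Y > 0" and a: "Re a > DIM('a) / 2"
  shows "integrable lborel (\<lambda>y. exp (- \<i> * of_real (w \<bullet> y)) / of_real (Y + (norm y)\<^sup>2) powr a)"
    and "(LINT y|lborel. exp (- \<i> * of_real (w \<bullet> y)) / of_real (Y + (norm y)\<^sup>2) powr a)
      = of_real (sqrt pi ^ DIM('a)) / Gamma a * schlaefli (a - of_nat DIM('a) / 2) Y ((norm w)\<^sup>2 / 4)"
proof -
  let ?d = "DIM('a)"
  \<comment> \<open>Joint integrand with t = exp x: integrating out x gives the inverse power times
    \<open>Gamma a\<close>, integrating out y gives a Schlaefli kernel.\<close>
  define f :: "real \<times> 'a \<Rightarrow> complex" where
    "f = (\<lambda>(x, y). exp (a * of_real x - of_real (Y * exp x)) * exp (- of_real (exp x * (norm y)\<^sup>2) - \<i> * of_real (w \<bullet> y)))"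
  have a0: "Re a > 0" using a by (rule le_less_trans[rotated]) simp
  then have Ga: "Gamma a \<noteq> 0" by (auto simp: Gamma_eq_zero_iff elim!: nonpos_Ints_cases)
  have sq: "sqrt (pi / exp x) ^ ?d = sqrt pi ^ ?d * exp (- (?d / 2 * x))" for x
  proof -
    have "sqrt (pi / exp x) = sqrt pi * exp (- (x / 2))"
      by (rule real_sqrt_unique) (simp_all add: power_mult_distrib exp_minus field_simps flip: exp_of_nat_mult)
    then show ?thesis by (simp add: power_mult_distrib flip: exp_of_nat_mult)
  qed
  have int: "integrable (lborel \<Otimes>\<^sub>M lborel) f"
  proof (rule lborel_pair.Fubini_integrable)
    show "f \<in> borel_measurable (lborel \<Otimes>\<^sub>M lborel)"
      unfolding lborel_prod measurable_lborel2 f_def case_prod_unfold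
      by (intro borel_measurable_continuous_onI continuous_intros)
    have "norm (f (x, y)) = exp (Re a * x - Y * exp x) * exp (- (exp x * (norm y)\<^sup>2))" for x y
      by (simp add: f_def norm_mult)
    then have "(LINT y|lborel. norm (f (x, y))) = exp (Re a * x - Y * exp x) * (sqrt pi ^ ?d * exp (- (?d / 2 * x)))" for x
      by (simp add: gaussian_integral(2) sq)
    also have "exp (Re a * x - Y * exp x) * (sqrt pi ^ ?d * exp (- (?d / 2 * x)))
        = sqrt pi ^ ?d * norm (exp ((a - of_nat ?d / 2) * of_real x - of_real (Y * exp x)))" for x
      by (simp add: algebra_simps flip: exp_add)
    finally show "integrable lborel (\<lambda>x. LINT y|lborel. norm (f (x, y)))"
      using a by (simp only:) (intro integrable_mult_right integrable_norm exp_shift_integral Y; simp)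
    show "AE x in lborel. integrable lborel (\<lambda>y. f (x, y))"
      unfolding f_def prod.case by (intro AE_I2 integrable_mult_right gaussian_fourier) simp
  qed
  have x: "(LINT x|lborel. f (x, y)) = Gamma a * (exp (- \<i> * of_real (w \<bullet> y)) / of_real (Y + (norm y)\<^sup>2) powr a)" for y
  proof -
    have pos: "Y + (norm y)\<^sup>2 > 0" using Y by (simp add: add_pos_nonneg)
    have "f (x, y) = exp (a * of_real x - of_real ((Y + (norm y)\<^sup>2) * exp x)) * exp (- \<i> * of_real (w \<bullet> y))" for x
      by (simp add: f_def algebra_simps flip: exp_add)
    then show ?thesis using exp_shift_integral[OF a0 pos] by simp
  qed
  have y: "(LINT y|lborel. f (x, y)) = of_real (sqrt pi ^ ?d) * schlaefli_kernel (a - of_nat ?d / 2) Y ((norm w)\<^sup>2 / 4) x" for x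
  proof -
    have "(LINT y|lborel. f (x, y)) = exp (a * of_real x - of_real (Y * exp x)) *
        of_real (sqrt pi ^ ?d * exp (- (?d / 2 * x)) * exp (- ((norm w)\<^sup>2 / (4 * exp x))))"
      unfolding f_def using gaussian_fourier(2)[of "exp x" w] by (simp only: exp_gt_zero simp_thms integral_mult_right_zero prod.case sq)
    also have "(norm w)\<^sup>2 / (4 * exp x) = (norm w)\<^sup>2 / 4 * exp (- x)"
      by (simp add: exp_minus field_simps)
    also have "exp (a * of_real x - of_real (Y * exp x)) *
        of_real (sqrt pi ^ ?d * exp (- (?d / 2 * x)) * exp (- ((norm w)\<^sup>2 / 4 * exp (- x))))
      = of_real (sqrt pi ^ ?d) * schlaefli_kernel (a - of_nat ?d / 2) Y ((norm w)\<^sup>2 / 4) x"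
      by (simp add: schlaefli_kernel_def algebra_simps flip: exp_add exp_of_real)
    finally show ?thesis .
  qed
  have "integrable lborel (\<lambda>y. Gamma a * (exp (- \<i> * of_real (w \<bullet> y)) / of_real (Y + (norm y)\<^sup>2) powr a))"
    unfolding x[symmetric] using lborel_pair.integrable_snd[of "\<lambda>x y. f (x, y)"] int by simp
  then show "integrable lborel (\<lambda>y. exp (- \<i> * of_real (w \<bullet> y)) / of_real (Y + (norm y)\<^sup>2) powr a)"
    by (rule integrable_mult_right[where c = "inverse (Gamma a)", THEN back_subst[of "integrable lborel"]]) (simp add: Ga flip: mult.assoc)
  have "Gamma a * (LINT y|lborel. exp (- \<i> * of_real (w \<bullet> y)) / of_real (Y + (norm y)\<^sup>2) powr a)
      = (LINT y|lborel. LINT x|lborel. f (x, y))"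
    unfolding x by (simp only: integral_mult_right_zero)
  also have "\<dots> = (LINT x|lborel. LINT y|lborel. f (x, y))"
    using lborel_pair.Fubini_integral[of "\<lambda>x y. f (x, y)"] int by simp
  also have "\<dots> = of_real (sqrt pi ^ ?d) * schlaefli (a - of_nat ?d / 2) Y ((norm w)\<^sup>2 / 4)"
    unfolding y schlaefli_def by (simp only: integral_mult_right_zero)
  finally show "(LINT y|lborel. exp (- \<i> * of_real (w \<bullet> y)) / of_real (Y + (norm y)\<^sup>2) powr a)
      = of_real (sqrt pi ^ ?d) / Gamma a * schlaefli (a - of_nat ?d / 2) Y ((norm w)\<^sup>2 / 4)"
    using Ga by (simp add: field_simps)
qed

lemma schlaefli_kernel_diff_of_nat:
  "schlaefli_kernel (\<nu> - of_nat n) A C x = of_real (exp (- x)) ^ n * schlaefli_kernel \<nu> A C x"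
proof (induction n)
  case (Suc n)
  have "schlaefli_kernel (\<nu> - of_nat (Suc n)) A C x = schlaefli_kernel (\<nu> - of_nat n - 1) A C x"
    by (simp add: algebra_simps)
  then show ?case unfolding schlaefli_kernel_diff_1 Suc by simp
qed simp

text \<open>Inside Schlaefli's integral, z occurs through a Gaussian of parameter q t. Its moment
  yields pi / (q t), the factor t to the power - \<alpha>, and exp (- |w|^2 / (4 q t)): the order
  drops by \<alpha> + 1 and the second coefficient grows.\<close>

lemma fourier_schlaefli:
  fixes w \<mu> :: complex
  assumes A: "A > 0" and C: "C > 0" and q: "q > 0"
  shows "integrable lborel (\<lambda>z. z ^ \<alpha> * exp (- \<i> * of_real (w \<bullet> z)) * schlaefli \<mu> (A + q * (norm z)\<^sup>2) C)"
    and "(LINT z|lborel. z ^ \<alpha> * exp (- \<i> * of_real (w \<bullet> z)) * schlaefli \<mu> (A + q * (norm z)\<^sup>2) C)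
      = of_real (pi / q) * (- \<i> * w / (2 * of_real q)) ^ \<alpha>
          * schlaefli (\<mu> - of_nat (Suc \<alpha>)) A (C + (norm w)\<^sup>2 / (4 * q))"
proof -
  define f :: "real \<times> complex \<Rightarrow> complex" where
    "f = (\<lambda>(x, z). schlaefli_kernel \<mu> A C x * (z ^ \<alpha> * exp (- of_real (q * exp x * (norm z)\<^sup>2) - \<i> * of_real (w \<bullet> z))))"
  let ?c = "fact \<alpha> * (2 / q) ^ \<alpha>"
  \<comment> \<open>The majorant given by \<open>complex_gaussian_moment_bound\<close> with p = q
    exp x. Integrating out z leaves kernels of orders \<mu> - 1 and \<mu> - (\<alpha> + 1),
    integrable at every order because \<open>C > 0\<close>.\<close>
  define g :: "real \<times> complex \<Rightarrow> real" where
    "g = (\<lambda>(x, z). (1 + ?c * exp (- x) ^ \<alpha>) * norm (schlaefli_kernel \<mu> A C x) * exp (- (q * exp x / 2 * (norm z)\<^sup>2)))"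
  have qx: "q * exp x > 0" for x using q by simp
  have g0: "g (x, z) \<ge> 0" for x z using q by (simp add: g_def)
  have intg: "integrable (lborel \<Otimes>\<^sub>M lborel) g"
  proof (rule lborel_pair.Fubini_integrable)
    show "g \<in> borel_measurable (lborel \<Otimes>\<^sub>M lborel)"
      unfolding lborel_prod measurable_lborel2 g_def case_prod_unfold schlaefli_kernel_def
      by (intro borel_measurable_continuous_onI continuous_intros) auto
    have "(LINT z|lborel. norm (g (x, z))) = (1 + ?c * exp (- x) ^ \<alpha>) * norm (schlaefli_kernel \<mu> A C x) * (pi / (q * exp x / 2))" for x
      using g0 qx[of x] gaussian_integral(2)[of "q * exp x / 2", where 'a = complex] unfolding g_def
      by simp
    also have "(1 + ?c * exp (- x) ^ \<alpha>) * norm (schlaefli_kernel \<mu> A C x) * (pi / (q * exp x / 2))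
       = 2 * pi / q * (norm (schlaefli_kernel (\<mu> - of_nat 1) A C x) + ?c * norm (schlaefli_kernel (\<mu> - of_nat (Suc \<alpha>)) A C x))" for x
      unfolding schlaefli_kernel_diff_of_nat norm_mult norm_power norm_of_real abs_exp_cancel
      by (simp add: exp_minus field_simps)
    finally show "integrable lborel (\<lambda>x. LINT y|lborel. norm (g (x, y)))"
      by (simp only:) (intro integrable_mult_right Bochner_Integration.integrable_add
          Bochner_Integration.integrable_norm schlaefli_integrable A C)
    show "AE x in lborel. integrable lborel (\<lambda>y. g (x, y))"
      unfolding g_def prod.case by (intro AE_I2 integrable_mult_right gaussian_integral) (use qx in auto)
  qed
  have int: "integrable (lborel \<Otimes>\<^sub>M lborel) f"
  proof (rule Bochner_Integration.integrable_bound[OF intg])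
    show "f \<in> borel_measurable (lborel \<Otimes>\<^sub>M lborel)"
      unfolding lborel_prod measurable_lborel2 f_def case_prod_unfold schlaefli_kernel_def
      by (intro borel_measurable_continuous_onI continuous_intros)
    have "norm (f (x, z)) \<le> norm (g (x, z))" for x z
    proof -
      have "norm (f (x, z)) \<le> norm (schlaefli_kernel \<mu> A C x) * ((1 + fact \<alpha> * (2 / (q * exp x)) ^ \<alpha>) * exp (- (q * exp x / 2 * (norm z)\<^sup>2)))"
        unfolding f_def prod.case norm_mult[of "schlaefli_kernel \<mu> A C x"]
        by (intro mult_left_mono complex_gaussian_moment_bound qx) simp
      also have "\<dots> = g (x, z)"
        unfolding g_def by (simp add: exp_minus power_divide power_mult_distrib field_simps)
      finally show ?thesis by simp
    qed
    then show "AE p in lborel \<Otimes>\<^sub>M lborel. norm (f p) \<le> norm (g p)" by auto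
  qed
  have x: "(LINT x|lborel. f (x, z)) = z ^ \<alpha> * exp (- \<i> * of_real (w \<bullet> z)) * schlaefli \<mu> (A + q * (norm z)\<^sup>2) C" for z
  proof -
    have "f (x, z) = z ^ \<alpha> * exp (- \<i> * of_real (w \<bullet> z)) * schlaefli_kernel \<mu> (A + q * (norm z)\<^sup>2) C x" for x
      by (simp add: f_def schlaefli_kernel_def algebra_simps flip: exp_add)
    then show ?thesis by (simp only: schlaefli_def integral_mult_right_zero)
  qed
  let ?K = "of_real (pi / q) * (- \<i> * w / (2 * of_real q)) ^ \<alpha>"
  have z: "(LINT z|lborel. f (x, z)) = ?K * schlaefli_kernel (\<mu> - of_nat (Suc \<alpha>)) A (C + (norm w)\<^sup>2 / (4 * q)) x" for x
  proof -
    have "(LINT z|lborel. f (x, z)) = schlaefli_kernel \<mu> A C x * (of_real (pi / (q * exp x)) *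
       (- \<i> * w / (2 * of_real (q * exp x))) ^ \<alpha> * exp (- of_real ((norm w)\<^sup>2 / (4 * (q * exp x)))))"
      unfolding f_def prod.case integral_mult_right_zero complex_gaussian_moment[OF qx] ..
    also have "\<dots> = ?K * (of_real (exp (- x)) ^ Suc \<alpha> * (schlaefli_kernel \<mu> A C x * exp (- of_real ((norm w)\<^sup>2 / (4 * q) * exp (- x)))))"
    proof -
      have "- \<i> * w / (2 * of_real (q * exp x)) = of_real (exp (- x)) * (- \<i> * w / (2 * of_real q))"
        "pi / (q * exp x) = exp (- x) * (pi / q)"
        "(norm w)\<^sup>2 / (4 * (q * exp x)) = (norm w)\<^sup>2 / (4 * q) * exp (- x)"
        by (simp_all add: exp_minus field_simps)
      then show ?thesis by (simp only: power_mult_distrib power_Suc of_real_mult mult_ac)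
    qed
    also have "schlaefli_kernel \<mu> A C x * exp (- of_real ((norm w)\<^sup>2 / (4 * q) * exp (- x))) = schlaefli_kernel \<mu> A (C + (norm w)\<^sup>2 / (4 * q)) x"
      by (simp add: schlaefli_kernel_def algebra_simps flip: exp_add)
    finally show ?thesis unfolding schlaefli_kernel_diff_of_nat .
  qed
  show "integrable lborel (\<lambda>z. z ^ \<alpha> * exp (- \<i> * of_real (w \<bullet> z)) * schlaefli \<mu> (A + q * (norm z)\<^sup>2) C)"
    unfolding x[symmetric] using lborel_pair.integrable_snd[of "\<lambda>x z. f (x, z)"] int by simp
  have "(LINT z|lborel. z ^ \<alpha> * exp (- \<i> * of_real (w \<bullet> z)) * schlaefli \<mu> (A + q * (norm z)\<^sup>2) C)
     = (LINT x|lborel. LINT z|lborel. f (x, z))"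
    unfolding x[symmetric] using lborel_pair.Fubini_integral[of "\<lambda>x z. f (x, z)"] int by simp
  also have "\<dots> = ?K * schlaefli (\<mu> - of_nat (Suc \<alpha>)) A (C + (norm w)\<^sup>2 / (4 * q))"
    unfolding z schlaefli_def by (simp only: integral_mult_right_zero)
  finally show "(LINT z|lborel. z ^ \<alpha> * exp (- \<i> * of_real (w \<bullet> z)) * schlaefli \<mu> (A + q * (norm z)\<^sup>2) C)
     = ?K * schlaefli (\<mu> - of_nat (Suc \<alpha>)) A (C + (norm w)\<^sup>2 / (4 * q))" .
qed

section \<open>The non-compact form of the highest weight vector\<close>

lemma norm_vcons: "(norm (vcons a u))\<^sup>2 = (cmod a)\<^sup>2 + (norm u)\<^sup>2"
proof -
  have "(norm (vcons a u))\<^sup>2 = (\<Sum>i\<in>UNIV. (cmod (vcons a u $ i))\<^sup>2)"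
    by (simp add: norm_vec_def L2_set_def sum_nonneg)
  also have "\<dots> = (cmod a)\<^sup>2 + (norm u)\<^sup>2"
    by (simp add: UNIV_option_conv sum.reindex vcons_def norm_vec_def L2_set_def sum_nonneg)
  finally show ?thesis .
qed

lemma norm_vector_smult: "norm (c *s (z :: complex ^ 'a)) = cmod c * norm z"
proof -
  have "(norm (c *s z))\<^sup>2 = (cmod c * norm z)\<^sup>2"
    by (simp add: norm_vec_def L2_set_def sum_nonneg norm_mult power_mult_distrib sum_distrib_left)
  then show ?thesis by (simp add: power2_eq_iff_nonneg)
qed

text \<open>\<open>P0\<close> has degree k in the modulus and phase t ^ \<alpha> * cnj t ^ \<beta> =
  t powi (- \<delta>) for |t| = 1. Dividing by the k-th power of the norm leaves the phase alone,
  and a radial power then gives the required homogeneity without changing values on the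
  sphere.\<close>

lemma noncompact_form_G_fun:
  fixes \<alpha> \<beta> k n :: nat
  assumes k: "\<alpha> + \<beta> = k" and \<delta>: "\<delta> = int \<beta> - int \<alpha>"
  shows "is_noncompact_form n lam \<delta> (P0 \<alpha> \<beta>) (G_fun n lam k \<alpha> :: complex \<Rightarrow> complex ^ 'm::finite \<Rightarrow> complex ^ 'm \<Rightarrow> complex)"
proof -
  define e where "e = - \<i> * complex_of_real lam - 2 * of_nat n"
  define g :: "complex ^ 'm option \<Rightarrow> complex ^ 'm option \<Rightarrow> complex" where
    "g = (\<lambda>z w. P0 \<alpha> \<beta> z w / of_real (norm (z, w)) ^ k * of_real (norm (z, w)) powr e)"
  have nz: "norm (c *s z, c *s w) = cmod c * norm (z, w)" for c and z w :: "complex ^ 'm option"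
  proof -
    have "norm (c *s z, c *s w) = sqrt ((cmod c)\<^sup>2 * ((norm z)\<^sup>2 + (norm w)\<^sup>2))"
      by (simp add: norm_Pair norm_vector_smult power_mult_distrib distrib_left)
    then show ?thesis by (simp add: real_sqrt_mult norm_Pair)
  qed
  have "homogeneous_extension n lam \<delta> (P0 \<alpha> \<beta>) g"
    unfolding homogeneous_extension_def
  proof (intro conjI allI impI)
    fix z w :: "complex ^ 'm option" assume "norm (z, w) = 1"
    then show "g z w = P0 \<alpha> \<beta> z w" by (simp add: g_def)
  next
    fix c :: complex and z w :: "complex ^ 'm option"
    assume c: "c \<noteq> 0" and zw: "(z, w) \<noteq> (0, 0)"
    define r where "r = norm (z, w)"
    have r: "r > 0" using zw unfolding r_def zero_prod_def[symmetric] by simp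
    define t where "t = c / of_real (cmod c)"
    have t: "t \<noteq> 0" "cmod t = 1" using c by (auto simp: t_def norm_divide)
    have ct: "c = of_real (cmod c) * t" using c by (simp add: t_def)
    have cnjt: "cnj t = inverse t" using t complex_norm_square[of t] by (simp add: field_simps)
    have "P0 \<alpha> \<beta> (c *s z) (c *s w) = c ^ \<alpha> * cnj c ^ \<beta> * P0 \<alpha> \<beta> z w"
      by (simp add: P0_def power_mult_distrib)
    also have "c ^ \<alpha> * cnj c ^ \<beta> = of_real (cmod c) ^ k * (t ^ \<alpha> * inverse t ^ \<beta>)"
      by (subst (1 2) ct) (simp add: cnjt power_mult_distrib power_add flip: k)
    also have "t ^ \<alpha> * inverse t ^ \<beta> = t powi (- \<delta>)"
      using t by (simp add: \<delta> power_int_diff divide_inverse power_inverse)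
    finally have P: "P0 \<alpha> \<beta> (c *s z) (c *s w) = of_real (cmod c) ^ k * t powi (- \<delta>) * P0 \<alpha> \<beta> z w" .
    have pw: "of_real (cmod c * r) powr e = of_real (cmod c) powr e * of_real r powr e"
      using c r by (simp add: powr_times_real)
    show "g (c *s z) (c *s w) = (c / complex_of_real (cmod c)) powi (- \<delta>) *
        complex_of_real (cmod c) powr (- \<i> * complex_of_real lam - 2 * of_nat n) * g z w"
      unfolding g_def nz P r_def[symmetric] t_def[symmetric] e_def[symmetric] pw
      using c r by (simp add: power_mult_distrib field_simps)
  qed
  moreover have "G_fun n lam k \<alpha> s u v = g (vcons 1 u) (vcons (2 * s) v)" for s u v
  proof -
    define r where "r = norm (vcons 1 u, vcons (2 * s) v)"
    define Q where "Q = 1 + 4 * (cmod s)\<^sup>2 + (norm u)\<^sup>2 + (norm v)\<^sup>2"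
    have r2: "r = sqrt Q"
      by (simp add: Q_def r_def norm_Pair norm_vcons norm_mult power_mult_distrib algebra_simps)
    have Q: "Q > 0" unfolding Q_def by (intro add_pos_nonneg) auto
    have L: "Ln (of_real r) = of_real (ln Q / 2)" "of_real r \<noteq> (0 :: complex)"
      using Q unfolding r2 by (simp_all add: Ln_of_real ln_sqrt)
    have rk: "(of_real r :: complex) ^ k = exp (of_nat k * of_real (ln Q / 2))"
      using L by (metis exp_Ln exp_of_nat_mult)
    have re: "of_real r powr e = exp (e * of_real (ln Q / 2))"
      using L by (simp only: powr_def if_False)
    have "g (vcons 1 u) (vcons (2 * s) v) = (2 * s) ^ \<alpha> * (of_real r powr e / of_real r ^ k)"
      unfolding g_def r_def[symmetric] by (simp add: P0_def vcons_def)
    \<comment> \<open>As \<open>r\<close> is the square root of \<open>Q\<close>, exponents are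
      halved: (e - k) / 2 is minus the exponent in \<open>G_fun\<close>.\<close>
    also have "of_real r powr e / of_real r ^ k = 1 / exp (((\<i> * complex_of_real lam + of_nat k) / 2 + of_nat n) * of_real (ln Q))"
    proof -
      have "e * of_real (ln Q / 2) - of_nat k * of_real (ln Q / 2)
          = - (((\<i> * complex_of_real lam + of_nat k) / 2 + of_nat n) * of_real (ln Q))"
        by (simp add: e_def field_simps)
      then show ?thesis
        unfolding rk re exp_diff[symmetric] by (simp only: exp_minus inverse_eq_divide)
    qed
    also have "exp (((\<i> * complex_of_real lam + of_nat k) / 2 + of_nat n) * of_real (ln Q))
        = of_real Q powr ((\<i> * complex_of_real lam + of_nat k) / 2 + of_nat n)"
      using Q by (simp add: powr_def Ln_of_real)
    finally show ?thesis by (simp add: G_fun_def Q_def)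
  qed
  ultimately show ?thesis unfolding is_noncompact_form_def by blast
qed

text \<open>The pairing \<open>bilin\<close> has no conjugation, whereas the real inner product
  conjugates one argument; this conjugate turns the phase into the inner product used by the
  Gaussian lemmas.\<close>

definition cvec :: "complex ^ 'm::finite \<Rightarrow> complex ^ 'm" where
  "cvec v = (\<chi> i. cnj (v $ i))"

lemma norm_cvec [simp]: "norm (cvec v) = norm v"
  by (simp add: cvec_def norm_vec_def)

lemma Re_bilin: "Re (bilin v y) = cvec v \<bullet> y"
  by (simp add: bilin_def cvec_def inner_vec_def inner_complex_def)

text \<open>Collects the constants: 2 ^ \<alpha> from (2 \<tau>) ^ \<alpha>, pi ^ m / Gamma a from
  the \<xi>-transform, pi / 4 and the \<alpha>-th power from the \<tau>-transform with q = 4, the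
  rest from Schlaefli's integral. The powers of pi add up to m + 1 + \<alpha> + 2 \<nu>, those of 2
  to - (\<nu> + \<alpha> + 1).\<close>

lemma fourier_constant:
  fixes \<nu> a :: complex and \<alpha> m :: nat
  assumes r: "r > 0" and z: "z = 2 * \<nu> + 1 + of_nat (m + \<alpha>)"
  shows "2 ^ \<alpha> * (of_real pi ^ m / Gamma a * (of_real (pi / 4) * (- \<i> * (2 * of_real pi * cnj s) / (2 * of_real 4)) ^ \<alpha>
          * (2 * of_real (pi\<^sup>2 / 2 * r) powr \<nu> * K)))
     = (- \<i> * cnj s) ^ \<alpha> * of_real pi powr z / (2 powr (\<nu> + of_nat \<alpha> + 1) * Gamma a) * of_real r powr \<nu> * K"
proof -
  let ?p = "complex_of_real pi"
  have e1: "(of_real (pi\<^sup>2 / 2 * r) :: complex) powr \<nu> = of_real (pi\<^sup>2 / 2) powr \<nu> * of_real r powr \<nu>"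
    using r by (intro powr_times_real[of "of_real _" "of_real _", folded of_real_mult]) auto
  have e2: "(of_real (pi\<^sup>2 / 2) :: complex) powr \<nu> = ?p powr (2 * \<nu>) / 2 powr \<nu>"
  proof -
    have "Ln (of_real (pi\<^sup>2 / 2)) = 2 * of_real (ln pi) - complex_of_real (ln 2)"
      by (subst Ln_of_real) (simp_all add: ln_div ln_realpow)
    then have "Ln (?p\<^sup>2 / 2) = 2 * of_real (ln pi) - of_real (ln 2)" by simp
    moreover have "Ln ?p = of_real (ln pi)" "Ln 2 = complex_of_real (ln 2)"
      using Ln_of_real[of pi] Ln_of_real[of 2] by simp_all
    ultimately show ?thesis
      by (simp add: powr_def right_diff_distrib exp_diff mult_ac)
  qed
  have e3: "(- \<i> * (2 * ?p * cnj s) / (2 * of_real 4)) ^ \<alpha> = (- \<i> * cnj s) ^ \<alpha> * ?p ^ \<alpha> / (2 ^ \<alpha> * 2 ^ \<alpha>)"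
  proof -
    have "- \<i> * (2 * ?p * cnj s) / (2 * of_real 4) = (- \<i> * cnj s) * ?p / (2 * 2)" by simp
    then show ?thesis by (simp only: power_mult_distrib power_divide)
  qed
  have e4: "?p powr z = ?p powr (2 * \<nu>) * ?p * ?p ^ m * ?p ^ \<alpha>"
    unfolding z by (simp add: powr_add powr_nat' power_add)
  have e5: "(2 :: complex) powr (\<nu> + of_nat \<alpha> + 1) = 2 powr \<nu> * 2 ^ \<alpha> * 2"
    by (simp add: powr_add powr_nat')
  show ?thesis unfolding e1 e2 e3 e4 e5 by (simp add: field_simps)
qed

text \<open>A Bochner integral is 0 by convention when its integrand is not integrable; the two
  integrability claims ensure that the iterated integral is genuine.\<close>

theorem theorem4p1:
  fixes n k \<alpha> \<beta> :: nat and lam :: real and \<delta> :: int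
    and G :: "complex \<Rightarrow> complex ^ 'm::finite \<Rightarrow> complex ^ 'm \<Rightarrow> complex"
    and E :: "complex \<Rightarrow> complex ^ 'm \<Rightarrow> complex ^ 'm \<Rightarrow> complex \<Rightarrow> complex ^ 'm \<Rightarrow> complex"
  assumes "n \<ge> 2" and "CARD('m) = n - 1"
    and "\<alpha> + \<beta> = k" and "\<delta> = int \<beta> - int \<alpha>"
    and "G = G_fun n lam k \<alpha>"
    and "E = (\<lambda>s u v \<tau> \<xi>.
          (2 * \<tau>) ^ \<alpha> /
          complex_of_real (1 + 4 * (cmod \<tau>)\<^sup>2 + (norm u)\<^sup>2 + (norm \<xi>)\<^sup>2)
            powr ((\<i> * complex_of_real lam + of_nat k) / 2 + of_nat n) *
          exp (- 2 * \<i> * complex_of_real pi * complex_of_real (Re (s * \<tau> + bilin v \<xi>))))"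
  shows "is_noncompact_form n lam \<delta> (P0 \<alpha> \<beta>) G \<and>
    (\<forall>s u v. s \<noteq> 0 \<longrightarrow> v \<noteq> 0 \<longrightarrow>
      (\<forall>\<tau>. integrable lborel (E s u v \<tau>)) \<and>
      integrable lborel (\<lambda>\<tau>. LINT \<xi>|lborel. E s u v \<tau> \<xi>) \<and>
      partial_fourier G s u v = (LINT \<tau>|lborel. LINT \<xi>|lborel. E s u v \<tau> \<xi>) \<and>
      (LINT \<tau>|lborel. LINT \<xi>|lborel. E s u v \<tau> \<xi>) =
        R_fun n lam k \<alpha> \<beta> \<delta> s u v *
        bessel_K ((\<i> * complex_of_real lam + of_int \<delta>) / 2)
          (complex_of_real (pi * sqrt (1 + (norm u)\<^sup>2) * sqrt ((cmod s)\<^sup>2 + 4 * (norm v)\<^sup>2))))"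
proof (intro conjI allI impI)
  show "is_noncompact_form n lam \<delta> (P0 \<alpha> \<beta>) G"
    unfolding assms(5) by (rule noncompact_form_G_fun) (fact assms)+
next
  fix s :: complex and u v :: "complex ^ 'm"
  assume s: "s \<noteq> 0" and v: "v \<noteq> 0"
  define m where "m = CARD('m)"
  have nm: "n = m + 1" using assms(1,2) by (simp add: m_def)
  define a where "a = (\<i> * complex_of_real lam + of_nat k) / 2 + of_nat n"
  define \<nu> where "\<nu> = (\<i> * complex_of_real lam + of_int \<delta>) / 2"
  define wv where "wv = (2 * pi) *\<^sub>R cvec v"
  define ws where "ws = 2 * of_real pi * cnj s"
  define A where "A = 1 + (norm u)\<^sup>2"
  define V where "V = (norm wv)\<^sup>2 / 4"
  have dim: "DIM(complex ^ 'm) = 2 * m" by (simp add: m_def)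
  have A: "A > 0" unfolding A_def by (intro add_pos_nonneg) auto
  have V: "V > 0" "V = pi\<^sup>2 * (norm v)\<^sup>2" using v by (auto simp: V_def wv_def power_mult_distrib)
  have Y: "A + 4 * (cmod \<tau>)\<^sup>2 > 0" for \<tau> using A by (intro add_pos_nonneg) auto
  \<comment> \<open>The real part is k / 2 + n and half the real dimension is m, so n = m + 1 leaves
    room.\<close>
  have Ra: "Re a > DIM(complex ^ 'm) / 2" unfolding dim a_def nm by simp
  have phv: "exp (- 2 * \<i> * complex_of_real pi * complex_of_real (Re (bilin v \<xi>))) = exp (- \<i> * of_real (wv \<bullet> \<xi>))" for \<xi>
    by (simp add: Re_bilin wv_def mult_ac)
  have phs: "exp (- 2 * \<i> * complex_of_real pi * complex_of_real (Re (s * \<tau>))) = exp (- \<i> * of_real (ws \<bullet> \<tau>))" for \<tau>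
    by (simp add: ws_def inner_complex_def algebra_simps)
  have Eeq: "E s u v \<tau> \<xi> = (2 * \<tau>) ^ \<alpha> * exp (- \<i> * of_real (ws \<bullet> \<tau>)) *
      (exp (- \<i> * of_real (wv \<bullet> \<xi>)) / of_real ((A + 4 * (cmod \<tau>)\<^sup>2) + (norm \<xi>)\<^sup>2) powr a)" for \<tau> \<xi>
  proof -
    have "exp (- 2 * \<i> * complex_of_real pi * complex_of_real (Re (s * \<tau> + bilin v \<xi>)))
       = exp (- \<i> * of_real (ws \<bullet> \<tau>)) * exp (- \<i> * of_real (wv \<bullet> \<xi>))"
      unfolding phs[symmetric] phv[symmetric] exp_add[symmetric] by (simp add: algebra_simps)
    moreover have "1 + 4 * (cmod \<tau>)\<^sup>2 + (norm u)\<^sup>2 + (norm \<xi>)\<^sup>2 = (A + 4 * (cmod \<tau>)\<^sup>2) + (norm \<xi>)\<^sup>2"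
      by (simp add: A_def)
    ultimately show ?thesis unfolding assms(6) a_def[symmetric] by (simp only: divide_inverse mult_ac)
  qed
  have int\<xi>: "integrable lborel (E s u v \<tau>)" for \<tau>
    unfolding Eeq[abs_def] by (intro integrable_mult_right fourier_inverse_power Y Ra)
  then show "integrable lborel (E s u v \<tau>)" for \<tau> .
  define \<kappa> where "\<kappa> = 2 ^ \<alpha> * (of_real pi ^ m / Gamma a)"
  have L\<xi>: "(LINT \<xi>|lborel. E s u v \<tau> \<xi>) = \<kappa> * (\<tau> ^ \<alpha> * exp (- \<i> * of_real (ws \<bullet> \<tau>)) * schlaefli (a - of_nat m) (A + 4 * (cmod \<tau>)\<^sup>2) V)" for \<tau>
  proof -
    have "(LINT \<xi>|lborel. E s u v \<tau> \<xi>) = (2 * \<tau>) ^ \<alpha> * exp (- \<i> * of_real (ws \<bullet> \<tau>)) *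
       (of_real (sqrt pi ^ (2 * m)) / Gamma a * schlaefli (a - of_nat (2 * m) / 2) (A + 4 * (cmod \<tau>)\<^sup>2) V)"
      unfolding Eeq integral_mult_right_zero fourier_inverse_power(2)[OF Y Ra] dim V_def ..
    also have "sqrt pi ^ (2 * m) = pi ^ m" by (simp add: power_mult)
    also have "of_nat (2 * m) / 2 = complex_of_nat m" by simp
    finally show ?thesis by (simp only: \<kappa>_def power_mult_distrib of_real_power mult_ac)
  qed
  have q4: "(0::real) < 4" by simp
  show "integrable lborel (\<lambda>\<tau>. LINT \<xi>|lborel. E s u v \<tau> \<xi>)"
    unfolding L\<xi> by (intro integrable_mult_right fourier_schlaefli A V q4)
  show "partial_fourier G s u v = (LINT \<tau>|lborel. LINT \<xi>|lborel. E s u v \<tau> \<xi>)"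
  proof -
    have "G \<tau> u \<xi> * exp (- 2 * \<i> * complex_of_real pi * complex_of_real (Re (bilin v \<xi>))) *
        exp (- 2 * \<i> * complex_of_real pi * complex_of_real (Re (s * \<tau>))) = E s u v \<tau> \<xi>" for \<tau> \<xi>
    proof -
      have "1 + 4 * (cmod \<tau>)\<^sup>2 + (norm u)\<^sup>2 + (norm \<xi>)\<^sup>2 = (A + 4 * (cmod \<tau>)\<^sup>2) + (norm \<xi>)\<^sup>2"
        by (simp add: A_def)
      then show ?thesis
        unfolding phv phs Eeq assms(5) G_fun_def a_def[symmetric] by (simp only: divide_inverse mult_ac)
    qed
    then show ?thesis
      unfolding partial_fourier_def F_tau_def F_xi_def o_def integral_mult_left_zero[symmetric] by simp
  qed
  define B where "B = sqrt ((cmod s)\<^sup>2 + 4 * (norm v)\<^sup>2)"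
  \<comment> \<open>The \<xi>-transform contributes pi^2 |v|^2 and the \<tau>-transform, with q = 4,
    pi^2 |s|^2 / 4; together they form the radicand |s|^2 + 4 |v|^2 of the Bessel argument.\<close>
  define C where "C = V + (norm ws)\<^sup>2 / (4 * 4)"
  have B: "B > 0" unfolding B_def using s by (simp add: add_pos_nonneg)
  have C: "C = pi\<^sup>2 * B\<^sup>2 / 4"
    unfolding C_def V(2) ws_def B_def by (simp add: norm_mult power_mult_distrib field_simps)
  have C0: "C > 0" unfolding C using B by simp
  define r where "r = B / (pi * sqrt A)"
  have r: "r > 0" using A B by (simp add: r_def)
  have sq1: "sqrt (C / A) = pi\<^sup>2 / 2 * r"
    using A B by (intro real_sqrt_unique) (simp_all add: C r_def power_mult_distrib power_divide field_simps power2_eq_square)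
  have sq2: "2 * sqrt (A * C) = pi * sqrt A * B"
  proof -
    have "sqrt (A * C) = pi * sqrt A * B / 2"
      using A B by (intro real_sqrt_unique) (simp_all add: C power_mult_distrib power_divide field_simps)
    then show ?thesis by simp
  qed
  have \<nu>: "a - of_nat m - of_nat (Suc \<alpha>) = \<nu>"
    unfolding a_def \<nu>_def nm assms(4) assms(3)[symmetric] by (simp add: field_simps)
  have "(LINT \<tau>|lborel. LINT \<xi>|lborel. E s u v \<tau> \<xi>) = \<kappa> * (of_real (pi / 4) * (- \<i> * ws / (2 * of_real 4)) ^ \<alpha> * schlaefli \<nu> A C)"
    unfolding L\<xi> integral_mult_right_zero fourier_schlaefli(2)[OF A V(1) q4] \<nu> C_def ..
  also have "schlaefli \<nu> A C = 2 * of_real (pi\<^sup>2 / 2 * r) powr \<nu> * bessel_K \<nu> (of_real (pi * sqrt A * B))"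
    unfolding schlaefli_bessel_K[OF A C0] sq1 sq2 ..
  also have "\<kappa> * (of_real (pi / 4) * (- \<i> * ws / (2 * of_real 4)) ^ \<alpha> * (2 * of_real (pi\<^sup>2 / 2 * r) powr \<nu> * bessel_K \<nu> (of_real (pi * sqrt A * B))))
      = (- \<i> * cnj s) ^ \<alpha> * of_real pi powr (\<i> * complex_of_real lam + of_nat \<beta> + of_nat n) / (2 powr (\<nu> + of_nat \<alpha> + 1) * Gamma a) * of_real r powr \<nu> * bessel_K \<nu> (of_real (pi * sqrt A * B))"
  proof -
    have "\<i> * complex_of_real lam + of_nat \<beta> + of_nat n = 2 * \<nu> + 1 + of_nat (m + \<alpha>)"
      unfolding \<nu>_def nm assms(4) by (simp add: field_simps)
    from fourier_constant[OF r this, of a s] show ?thesis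
      unfolding \<kappa>_def ws_def by (simp only: mult.assoc)
  qed
  also have "\<nu> + of_nat \<alpha> + 1 = (\<i> * complex_of_real lam + of_nat k) / 2 + 1"
    unfolding \<nu>_def assms(4) assms(3)[symmetric] by (simp add: field_simps)
  finally show "(LINT \<tau>|lborel. LINT \<xi>|lborel. E s u v \<tau> \<xi>) =
        R_fun n lam k \<alpha> \<beta> \<delta> s u v *
        bessel_K ((\<i> * complex_of_real lam + of_int \<delta>) / 2)
          (complex_of_real (pi * sqrt (1 + (norm u)\<^sup>2) * sqrt ((cmod s)\<^sup>2 + 4 * (norm v)\<^sup>2)))"
    unfolding R_fun_def a_def \<nu>_def r_def A_def B_def .
qed

end
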